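(* Let $F$ be a face (cycle) of a plane graph, $D$ a multiset of demand edges (each of demand $1$) with endpoints on $F$, and $S\subseteq F$ a contiguous segment such that every $uv\in D$ satisfies $|\{u,v\}\cap S|=1$. Then there exist laminar demand multisets $L_1,L_2$ on $F$ such that $L_1\le D$, $L_2\le 2D$, and $L_1+L_2\ge D$. Moreover, $L_1$ and $L_2$ can be found in polynomial time.
   Context: A contiguous segment of $F$ is a set of vertices forming a contiguous interval along the cycle $F$. For a demand multiset $H$ on $F$ and segment $S$, $\delta_H(S)$ is the number of edges of $H$ with exactly one endpoint in $S$. $H\ge H'$ (equivalently $H'\le H$) means $\delta_H(S)\ge\delta_{H'}(S)$ for every contiguous segment $S$ of $F$. $2D$ is $D$ with each edge repeated twice; $L_1+L_2$ is the multiset union. Two demand edges $uv,xy$ cross if $u,x,v,y$ appear in this cyclic order on $F$; a demand multiset is laminar if no two of its edges cross. *)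

theory Defs
  imports
    "HOL-Analysis.Analysis"
    "HOL-Library.Multiset"
    "HOL-Library.Sublist"
    "HOL-Computational_Algebra.Polynomial"
begin

section \<open>Plane graphs and facial cycles\<close>

text \<open>
  A plane graph is a pair \<open>(V, E)\<close> of finitely many points of the plane and finitely many
  edges, an edge being the point set traced by a simple path that meets \<open>V\<close> exactly in its ends.
  Parallel edges and loops are allowed.
\<close>

type_synonym plane_graph = "complex set \<times> complex set set"

definition plane_graph :: "plane_graph \<Rightarrow> bool" where
  "plane_graph G \<longleftrightarrow> (case G of (V, E) \<Rightarrow>
     finite V \<and> finite E \<and>
     (\<forall>e\<in>E. \<exists>g. simple_path g \<and> path_image g = e \<and> e \<inter> V = {pathstart g, pathfinish g}) \<and>
     (\<forall>e\<in>E. \<forall>f\<in>E. e \<noteq> f \<longrightarrow> e \<inter> f \<subseteq> V))"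

definition faces :: "plane_graph \<Rightarrow> complex set set" where
  "faces G = components (- (fst G \<union> \<Union> (snd G)))"

text \<open>
  \<open>F\<close> lists the vertices of a cycle of \<open>G\<close> in cyclic order, and this cycle is the boundary of a
  face. The requirement that \<open>es\<close> be distinct matters only for cycles of length two, which consist
  of two parallel edges.
\<close>

definition facial_cycle :: "plane_graph \<Rightarrow> complex list \<Rightarrow> bool" where
  "facial_cycle G F \<longleftrightarrow>
     F \<noteq> [] \<and> distinct F \<and>
     (\<exists>C\<in>faces G. \<exists>es. length es = length F \<and> distinct es \<and> set es \<subseteq> snd G \<and>
        (\<forall>i<length F. es ! i \<inter> fst G = {F ! i, F ! (Suc i mod length F)}) \<and>
        frontier C = \<Union> (set es))"


section \<open>Demand multisets on a cycle\<close>

text \<open>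
  In this section \<open>F\<close> is the list of the vertices of a cycle in cyclic order. Demand edges are
  two-element vertex sets.
\<close>

definition demands_on :: "'v list \<Rightarrow> 'v set multiset \<Rightarrow> bool" where
  "demands_on F H \<longleftrightarrow> (\<forall>e\<in>#H. e \<subseteq> set F \<and> card e = 2)"

definition contiguous_segment :: "'v list \<Rightarrow> 'v set \<Rightarrow> bool" where
  "contiguous_segment F S \<longleftrightarrow> (\<exists>m k. S = set (take k (rotate m F)))"

definition cut_size :: "'v set multiset \<Rightarrow> 'v set \<Rightarrow> nat" where
  "cut_size H S = size {#e \<in># H. card (e \<inter> S) = 1#}"

definition dominated_by :: "'v list \<Rightarrow> 'v set multiset \<Rightarrow> 'v set multiset \<Rightarrow> bool" where
  "dominated_by F H' H \<longleftrightarrow> (\<forall>S. contiguous_segment F S \<longrightarrow> cut_size H' S \<le> cut_size H S)"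

definition crossing :: "'v list \<Rightarrow> 'v set \<Rightarrow> 'v set \<Rightarrow> bool" where
  "crossing F e f \<longleftrightarrow>
     (\<exists>u v x y. e = {u, v} \<and> f = {x, y} \<and> (\<exists>m. subseq [u, x, v, y] (rotate m F)))"

definition laminar_demands :: "'v list \<Rightarrow> 'v set multiset \<Rightarrow> bool" where
  "laminar_demands F L \<longleftrightarrow> demands_on F L \<and> (\<forall>e\<in>#L. \<forall>f\<in>#L. \<not> crossing F e f)"

definition laminar_cover ::
    "'v list \<Rightarrow> 'v set multiset \<Rightarrow> 'v set multiset \<Rightarrow> 'v set multiset \<Rightarrow> bool" where
  "laminar_cover F D L1 L2 \<longleftrightarrow>
     laminar_demands F L1 \<and> laminar_demands F L2 \<and>
     dominated_by F L1 D \<and> dominated_by F L2 (repeat_mset 2 D) \<and> dominated_by F D (L1 + L2)"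

definition segment_instance ::
    "plane_graph \<Rightarrow> complex list \<Rightarrow> complex set multiset \<Rightarrow> complex set \<Rightarrow> bool" where
  "segment_instance G F D S \<longleftrightarrow>
     plane_graph G \<and> facial_cycle G F \<and> demands_on F D \<and> contiguous_segment F S \<and>
     (\<forall>e\<in>#D. card (e \<inter> S) = 1)"


section \<open>Running time\<close>

text \<open>
  The machine model consists of first-order recursive programs over binary trees (as in Jones,
  \<^emph>\<open>Computability and Complexity\<close>): values are built from the empty tree by pairing, the only
  operations are pairing, the two projections, the test for emptiness and calls of the program's
  own functions, and each operation costs one step. There is no test for equality and no
  arithmetic. Values can be kept as shared pointers, so this model and Turing machines simulate
  each other with polynomial overhead. As sharing may make a tree larger than the time spent on
  building it, the size of the result has to be bounded along with the number of steps.
\<close>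

datatype btree = Leaf | Node btree btree

datatype expr =
    Arg nat
  | Empty
  | Pairing expr expr
  | Left expr
  | Right expr
  | Cond expr expr expr
  | Call nat "expr list"

type_synonym prog = "expr list"

fun left_of :: "btree \<Rightarrow> btree" where
  "left_of Leaf = Leaf"
| "left_of (Node a b) = a"

fun right_of :: "btree \<Rightarrow> btree" where
  "right_of Leaf = Leaf"
| "right_of (Node a b) = b"

text \<open>
  \<open>eval P vs e b t\<close>: under the program \<open>P\<close> (the list of the function bodies) and the arguments
  \<open>vs\<close> of the current call, the expression \<open>e\<close> evaluates to \<open>b\<close> in \<open>t\<close> steps.
\<close>

inductive eval :: "prog \<Rightarrow> btree list \<Rightarrow> expr \<Rightarrow> btree \<Rightarrow> nat \<Rightarrow> bool"
  and evals :: "prog \<Rightarrow> btree list \<Rightarrow> expr list \<Rightarrow> btree list \<Rightarrow> nat \<Rightarrow> bool"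
  for P :: prog
where
  Arg: "i < length vs \<Longrightarrow> eval P vs (Arg i) (vs ! i) 1"
| Empty: "eval P vs Empty Leaf 1"
| Pairing: "eval P vs e1 a s \<Longrightarrow> eval P vs e2 b t \<Longrightarrow>
    eval P vs (Pairing e1 e2) (Node a b) (s + t + 1)"
| Left: "eval P vs e a s \<Longrightarrow> eval P vs (Left e) (left_of a) (s + 1)"
| Right: "eval P vs e a s \<Longrightarrow> eval P vs (Right e) (right_of a) (s + 1)"
| Cond_Node: "eval P vs e a s \<Longrightarrow> a \<noteq> Leaf \<Longrightarrow> eval P vs e1 b t \<Longrightarrow>
    eval P vs (Cond e e1 e2) b (s + t + 1)"
| Cond_Leaf: "eval P vs e Leaf s \<Longrightarrow> eval P vs e2 b t \<Longrightarrow>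
    eval P vs (Cond e e1 e2) b (s + t + 1)"
| Call: "f < length P \<Longrightarrow> evals P vs es ws s \<Longrightarrow> eval P ws (P ! f) b t \<Longrightarrow>
    eval P vs (Call f es) b (s + t + 1)"
| evals_Nil: "evals P vs [] [] 0"
| evals_Cons: "eval P vs e a s \<Longrightarrow> evals P vs es as t \<Longrightarrow> evals P vs (e # es) (a # as) (s + t)"

lemma eval_deterministic:
  "eval P vs e b t \<Longrightarrow> eval P vs e b' t' \<Longrightarrow> b = b' \<and> t = t'"
  "evals P vs es bs t \<Longrightarrow> evals P vs es bs' t' \<Longrightarrow> bs = bs' \<and> t = t'"
proof (induction arbitrary: b' t' and bs' t' rule: eval_evals.inducts)
  case (Arg i vs)
  then show ?case by (auto elim: eval.cases)
next
  case (Empty vs)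
  then show ?case by (auto elim: eval.cases)
next
  case (Pairing vs e1 a s e2 b t)
  from Pairing.prems show ?case by cases (use Pairing.IH in blast)+
next
  case (Left vs e a s)
  from Left.prems show ?case by cases (use Left.IH in blast)+
next
  case (Right vs e a s)
  from Right.prems show ?case by cases (use Right.IH in blast)+
next
  case (Cond_Node vs e a s e1 b t e2)
  from Cond_Node.prems show ?case by cases (use Cond_Node.IH Cond_Node.hyps in blast)+
next
  case (Cond_Leaf vs e s e2 b t e1)
  from Cond_Leaf.prems show ?case by cases (use Cond_Leaf.IH in blast)+
next
  case (Call f vs es ws s b t)
  from Call.prems show ?case by cases (use Call.IH in blast)+
next
  case (evals_Nil vs)
  then show ?case by (auto elim: evals.cases)
next
  case (evals_Cons vs e a s es as t)
  from evals_Cons.prems show ?case by cases (use evals_Cons.IH in blast)+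
qed

definition runs :: "prog \<Rightarrow> btree \<Rightarrow> btree \<Rightarrow> nat \<Rightarrow> bool" where
  "runs P a b t \<longleftrightarrow> eval P [a] (Call 0 [Arg 0]) b t"


section \<open>Encoding of instances and results\<close>

text \<open>
  Vertices of the cycle are named by their positions in \<open>F\<close>. Numbers are written in unary; none
  of them exceeds the length of the cycle, which is itself part of the input size.
\<close>

fun enc_nat :: "nat \<Rightarrow> btree" where
  "enc_nat 0 = Leaf"
| "enc_nat (Suc n) = Node Leaf (enc_nat n)"

fun enc_edges :: "(nat \<times> nat) list \<Rightarrow> btree" where
  "enc_edges [] = Leaf"
| "enc_edges ((i, j) # es) = Node (Node (enc_nat i) (enc_nat j)) (enc_edges es)"

definition lists_demands :: "'v list \<Rightarrow> (nat \<times> nat) list \<Rightarrow> 'v set multiset \<Rightarrow> bool" where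
  "lists_demands F es H \<longleftrightarrow>
     (\<forall>(i, j)\<in>set es. i < length F \<and> j < length F) \<and>
     H = mset (map (\<lambda>(i, j). {F ! i, F ! j}) es)"

text \<open>
  The input consists of the length of the cycle, the first position and the number of vertices of
  the segment, and the demand edges in any order and orientation.
\<close>

definition encodes_input :: "'v list \<Rightarrow> 'v set multiset \<Rightarrow> 'v set \<Rightarrow> btree \<Rightarrow> bool" where
  "encodes_input F D S a \<longleftrightarrow>
     (\<exists>m k es. m < length F \<and> k \<le> length F \<and> S = set (take k (rotate m F)) \<and>
        lists_demands F es D \<and>
        a = Node (enc_nat (length F)) (Node (Node (enc_nat m) (enc_nat k)) (enc_edges es)))"

definition encodes_output :: "'v list \<Rightarrow> 'v set multiset \<Rightarrow> 'v set multiset \<Rightarrow> btree \<Rightarrow> bool" where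
  "encodes_output F L1 L2 b \<longleftrightarrow>
     (\<exists>es1 es2. lists_demands F es1 L1 \<and> lists_demands F es2 L2 \<and>
        b = Node (enc_edges es1) (enc_edges es2))"

end

theory Submission imports Defs begin

text \<open>
  Read the cycle from the first vertex of \<open>S\<close> on, so that \<open>S\<close> is a prefix and its complement \<open>T\<close>
  a suffix of a line; up to complements, the contiguous segments are the intervals. A height
  function on the line that vanishes at both ends yields a laminar multiset: read each unit of
  ascent as an opening and each unit of descent as a closing parenthesis, and join matching ones.

  \<open>L1\<close> is obtained from the height \<open>i \<mapsto> \<delta>\<^sub>D([i, n))\<close>. It joins \<open>S\<close> to \<open>T\<close> and has the degrees of \<open>D\<close>, so
  it agrees with \<open>D\<close> on the intervals inside \<open>S\<close> or \<open>T\<close>. Any other interval is the complement of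
  \<open>A \<union> B\<close> for a prefix \<open>A\<close> of \<open>S\<close> and a suffix \<open>B\<close> of \<open>T\<close>. Let \<open>x\<close> be the number of demands that have
  an end in \<open>A\<close> but none in \<open>B\<close>, and \<open>y\<close> the number of those with an end in \<open>B\<close> but none in \<open>A\<close>. Then
  \<open>D\<close> has cut \<open>x + y\<close>, and \<open>L1\<close>, being laminar, has cut \<open>\<bar>deg A - deg B\<bar> = \<bar>x - y\<bar>\<close>. So \<open>L2\<close> has to
  contribute at least \<open>2 * min x y\<close> and at most \<open>2 * (x + y)\<close>.

  \<open>L2\<close> consists of two copies of the matching inside \<open>S\<close> with height \<open>h(i) = min\<^sub>j \<delta>\<^sub>D([i, j))\<close>, where
  the end \<open>j\<close> ranges over \<open>T\<close>. It has cut \<open>2 * h(i)\<close> on the interval above, and \<open>min x y \<le> h(i) \<le> x + y\<close>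
  because \<open>x\<close> decreases and \<open>y\<close> increases with \<open>B\<close>. On the intervals inside \<open>S\<close> it is bounded by degrees,
  since \<open>h\<close> changes at a vertex by at most its degree in \<open>D\<close>.
\<close>

section \<open>Parenthesis matchings\<close>

definition cut_count :: "(nat \<times> nat) list \<Rightarrow> nat set \<Rightarrow> nat" where
  "cut_count es X = length (filter (\<lambda>(i, j). (i \<in> X) \<noteq> (j \<in> X)) es)"

text \<open>The minimum is over the sets consisting of \<open>xs\<close> and a prefix of the last argument.\<close>

fun min_cut :: "(nat \<times> nat) list \<Rightarrow> nat list \<Rightarrow> nat list \<Rightarrow> nat" where
  "min_cut es xs [] = cut_count es (set xs)"
| "min_cut es xs (y # ys) = min (cut_count es (set xs)) (min_cut es (y # xs) ys)"

text \<open>The letters \<open>(v, True)\<close> and \<open>(v, False)\<close> are parentheses opened and closed at \<open>v\<close>.\<close>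

fun steps :: "nat \<Rightarrow> nat \<Rightarrow> nat \<Rightarrow> (nat \<times> bool) list \<Rightarrow> (nat \<times> bool) list" where
  "steps v 0 0 w = w"
| "steps v 0 (Suc b) w = (v, True) # steps v 0 b w"
| "steps v (Suc a) 0 w = (v, False) # steps v a 0 w"
| "steps v (Suc a) (Suc b) w = steps v a b w"

text \<open>The word is built from the right: the letters at \<open>v\<close> lead from the height
  of the suffix \<open>v # vs\<close> to that of \<open>vs\<close>. With \<open>ys\<close> empty the
  height is the plain cut of a suffix, as for \<open>L1\<close>; with \<open>ys\<close> listing
  \<open>T\<close> it is the minimum h used for \<open>L2\<close>.\<close>

fun profile_word :: "(nat \<times> nat) list \<Rightarrow> nat list \<Rightarrow> nat list \<Rightarrow> (nat \<times> bool) list" where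
  "profile_word es [] ys = []"
| "profile_word es (v # vs) ys =
     steps v (min_cut es (v # vs) ys) (min_cut es vs ys) (profile_word es vs ys)"

text \<open>The third equation, for a closing parenthesis without partner, mirrors the behaviour of the
  program; it does not occur on the words in question.\<close>

fun stack_matching :: "nat list \<Rightarrow> (nat \<times> bool) list \<Rightarrow> (nat \<times> nat) list" where
  "stack_matching st [] = []"
| "stack_matching st ((v, True) # w) = stack_matching (v # st) w"
| "stack_matching [] ((v, False) # w) = (0, v) # stack_matching [] w"
| "stack_matching (q # st) ((v, False) # w) = (q, v) # stack_matching st w"

definition straight_matching :: "(nat \<times> nat) list \<Rightarrow> nat list \<Rightarrow> (nat \<times> nat) list" where
  "straight_matching es vs = stack_matching [] (profile_word es vs [])"

definition left_matching :: "(nat \<times> nat) list \<Rightarrow> nat list \<Rightarrow> nat list \<Rightarrow> (nat \<times> nat) list" where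
  "left_matching es vs ys = stack_matching [] (profile_word es vs ys)"

text \<open>Truncated subtraction makes at least one of the two blocks empty.\<close>

lemma steps_eq: "steps v a b w = replicate (b - a) (v, True) @ replicate (a - b) (v, False) @ w"
  by (induction v a b w rule: steps.induct) auto

text \<open>This is the degree sum over \<open>X\<close>; an edge inside \<open>X\<close> counts
  twice.\<close>

definition incidences :: "(nat \<times> nat) list \<Rightarrow> nat set \<Rightarrow> nat" where
  "incidences es X = length (filter (\<lambda>e. fst e \<in> X) es) + length (filter (\<lambda>e. snd e \<in> X) es)"

lemma cut_count_simps [simp]:
  "cut_count [] X = 0"
  "cut_count ((i, j) # es) X = (if (i \<in> X) \<noteq> (j \<in> X) then 1 else 0) + cut_count es X"
  by (auto simp: cut_count_def)

lemma incidences_simps [simp]: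
  "incidences [] X = 0"
  "incidences ((i, j) # es) X =
     (if i \<in> X then 1 else 0) + (if j \<in> X then 1 else 0) + incidences es X"
  by (auto simp: incidences_def)

lemma cut_count_cong:
  "(\<And>i j. (i, j) \<in> set es \<Longrightarrow> ((i \<in> X) \<noteq> (j \<in> X)) = ((i \<in> Y) \<noteq> (j \<in> Y))) \<Longrightarrow>
    cut_count es X = cut_count es Y"
  unfolding cut_count_def by (rule arg_cong[where f = length], rule filter_cong) auto

lemma incidences_cong:
  "(\<And>i j. (i, j) \<in> set es \<Longrightarrow> (i \<in> X) = (i \<in> Y) \<and> (j \<in> X) = (j \<in> Y)) \<Longrightarrow>
    incidences es X = incidences es Y"
  unfolding incidences_def
  by (intro arg_cong2[where f = "(+)"] arg_cong[where f = length] filter_cong) auto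

lemma cut_count_le_incidences: "cut_count es X \<le> incidences es X"
  by (induction es) auto

lemma cut_count_eq_incidences:
  "\<forall>(i, j)\<in>set es. i \<notin> X \<or> j \<notin> X \<Longrightarrow> cut_count es X = incidences es X"
  by (induction es) auto

lemma incidences_insert:
  "v \<notin> X \<Longrightarrow> incidences es (insert v X) = incidences es {v} + incidences es X"
  by (induction es) auto

lemma cut_count_insert_le: "cut_count es (insert v X) \<le> cut_count es X + incidences es {v}"
  by (induction es) auto

lemma cut_count_le_insert: "cut_count es X \<le> cut_count es (insert v X) + incidences es {v}"
  by (induction es) auto

section \<open>Minimum cuts over prefixes\<close>

lemma min_cut_cong: "set xs = set xs' \<Longrightarrow> min_cut es xs ys = min_cut es xs' ys"
proof (induction ys arbitrary: xs xs')
  case (Cons y ys)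
  then have "min_cut es (y # xs) ys = min_cut es (y # xs') ys" by (metis list.simps(15))
  with Cons.prems show ?case by simp
qed simp

text \<open>One vertex changes any cut by at most its degree, and a minimum over the same family of
  prefixes inherits this bound. Together with the converse bound below, this limits the number of
  letters at a vertex.\<close>

lemma min_cut_Cons_le: "min_cut es (v # xs) ys \<le> min_cut es xs ys + incidences es {v}"
proof (induction ys arbitrary: xs)
  case (Cons y ys)
  have "min_cut es (y # v # xs) ys = min_cut es (v # y # xs) ys" by (rule min_cut_cong) auto
  with Cons[of "y # xs"] cut_count_insert_le[of es v "set xs"] show ?case
    by (auto simp: min_def)
qed (simp add: cut_count_insert_le)

lemma min_cut_le_Cons: "min_cut es xs ys \<le> min_cut es (v # xs) ys + incidences es {v}"
proof (induction ys arbitrary: xs)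
  case (Cons y ys)
  have "min_cut es (y # v # xs) ys = min_cut es (v # y # xs) ys" by (rule min_cut_cong) auto
  with Cons[of "y # xs"] cut_count_le_insert[of es "set xs" v] show ?case
    by (auto simp: min_def)
qed (simp add: cut_count_le_insert)

lemma min_cut_le: "min_cut es xs (q @ w) \<le> cut_count es (set xs \<union> set q)"
proof (induction q arbitrary: xs)
  case Nil
  show ?case by (cases w) auto
next
  case (Cons y q)
  from Cons[of "y # xs"] show ?case by (simp add: min.coboundedI2)
qed

lemma min_cut_attained:
  "\<exists>q w. ys = q @ w \<and> min_cut es xs ys = cut_count es (set xs \<union> set q)"
proof (induction ys arbitrary: xs)
  case (Cons y ys)
  from Cons[of "y # xs"] obtain q w where qw: "ys = q @ w"
    "min_cut es (y # xs) ys = cut_count es (set (y # xs) \<union> set q)" by blast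
  show ?case
  proof (cases "cut_count es (set xs) \<le> min_cut es (y # xs) ys")
    case True
    then have "y # ys = [] @ (y # ys) \<and>
        min_cut es xs (y # ys) = cut_count es (set xs \<union> set [])" by simp
    then show ?thesis by blast
  next
    case False
    then have "y # ys = (y # q) @ w \<and>
        min_cut es xs (y # ys) = cut_count es (set xs \<union> set (y # q))"
      using qw by simp
    then show ?thesis by blast
  qed
qed simp

lemma cut_count_empty [simp]: "cut_count es {} = 0"
  by (induction es) auto

text \<open>The empty prefix contributes the cut of the empty set. Thus the height vanishes at the
  right end.\<close>

lemma min_cut_Nil [simp]: "min_cut es [] ys = 0"
  using min_cut_le[of es "[]" "[]" ys] by simp

section \<open>Balanced words and their matchings\<close>

text \<open>\<open>closes h w\<close>: after \<open>h\<close> opening parentheses, \<open>w\<close> completes a balanced word.\<close>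

fun closes :: "nat \<Rightarrow> (nat \<times> bool) list \<Rightarrow> bool" where
  "closes h [] \<longleftrightarrow> h = 0"
| "closes h ((v, True) # w) \<longleftrightarrow> closes (Suc h) w"
| "closes h ((v, False) # w) \<longleftrightarrow> 0 < h \<and> closes (h - 1) w"

text \<open>The height is the surplus of closing over opening letters in the word, so a prescribed
  height at a point of a word is also the height of the stack there.\<close>

lemma closes_unique: "closes h w \<Longrightarrow> closes h' w \<Longrightarrow> h = h'"
proof (induction h w arbitrary: h' rule: closes.induct)
  case (2 h v w)
  then show ?case by fastforce
next
  case (3 h v w)
  from "3.prems" "3.IH"[of "h' - 1"] show ?case by auto
qed auto

lemma closes_replicate_True: "closes h (replicate c (v, True) @ w) \<longleftrightarrow> closes (h + c) w"
  by (induction c arbitrary: h) auto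

lemma closes_replicate_False:
  "closes h (replicate c (v, False) @ w) \<longleftrightarrow> c \<le> h \<and> closes (h - c) w"
proof (induction c arbitrary: h)
  case (Suc c)
  then show ?case by (cases h) simp_all
qed simp

lemma closes_steps: "closes b w \<Longrightarrow> closes a (steps v a b w)"
  by (cases "a \<le> b") (simp_all add: steps_eq closes_replicate_True closes_replicate_False)

lemma closes_profile_word: "closes (min_cut es vs ys) (profile_word es vs ys)"
  by (induction vs) (auto intro: closes_steps)

text \<open>\<open>closes\<close> rules out a closing letter on an empty stack, whose default
  partner \<open>0\<close> need not come from any opening letter.\<close>

lemma stack_matching_ends:
  assumes "closes (length st) w" "(q, v) \<in> set (stack_matching st w)"
  shows "q \<in> set st \<or> (q, True) \<in> set w" "(v, False) \<in> set w"
  using assms by (induction st w rule: stack_matching.induct) auto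

text \<open>Every stack entry and every letter becomes the end of exactly one edge, so degrees can
  be read off the word.\<close>

lemma incidences_stack_matching:
  "closes (length st) w \<Longrightarrow> incidences (stack_matching st w) X =
    length (filter (\<lambda>v. v \<in> X) st) + length (filter (\<lambda>x. fst x \<in> X) w)"
  by (induction st w rule: stack_matching.induct) auto

text \<open>The bottom of the stack was pushed first, hence \<open>rev st\<close>: stack and
  remaining word together run along the line. The order is weak because a vertex may carry several
  letters.\<close>

lemma stack_matching_ordered:
  assumes "closes (length st) w" "sorted (map pos (rev st) @ map (\<lambda>x. pos (fst x)) w)"
    and "(q, v) \<in> set (stack_matching st w)"
  shows "(pos q :: nat) \<le> pos v"
  using assms
  by (induction st w rule: stack_matching.induct) (auto simp: sorted_append)

lemma stack_matching_noncrossing: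
  assumes "closes (length st) w" "sorted (map pos (rev st) @ map (\<lambda>x. pos (fst x)) w)"
    and "(q, v) \<in> set (stack_matching st w)" "(q', v') \<in> set (stack_matching st w)"
  shows "\<not> ((pos q :: nat) < pos q' \<and> pos q' < pos v \<and> pos v < pos v')"
  using assms
proof (induction st w rule: stack_matching.induct)
  case (4 q0 st v0 w)
  have closes: "closes (length st) w" using "4.prems" by simp
  have sorted: "sorted (map pos (rev st) @ map (\<lambda>x. pos (fst x)) w)"
    using "4.prems"(2) by (auto simp: sorted_append)
  \<comment> \<open>The new edge joins the top of the stack to the current letter. Every other end
    comes from deeper in the stack, hence not right of \<open>q0\<close>, or from later in the word,
    hence not left of \<open>v0\<close>.\<close>
  have outside: "(pos a \<le> pos q0 \<or> pos v0 \<le> pos a) \<and> pos v0 \<le> pos b"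
    if "(a, b) \<in> set (stack_matching st w)" for a b
  proof -
    have "\<forall>x\<in>set st. pos x \<le> pos q0" "\<forall>x\<in>set w. pos v0 \<le> pos (fst x)"
      using "4.prems"(2) by (auto simp: sorted_append)
    then show ?thesis using stack_matching_ends[OF closes that] by force
  qed
  show ?case
    using "4.IH"[OF closes sorted] "4.prems"(3,4) outside[of q v] outside[of q' v'] by auto
qed (auto simp: sorted_append)

text \<open>The parentheses opened in \<open>X\<close> sit at the bottom as \<open>st1\<close>.
  Letters of \<open>w\<close> lie outside \<open>X\<close> and push and pop on \<open>st2\<close>
  first; each entry of \<open>st1\<close> finally meets a closing letter outside \<open>X\<close>,
  and these are the only cut edges.\<close>

lemma cut_count_stack_matching_bottom:
  assumes "closes (length (st2 @ st1)) w" "set st1 \<subseteq> X" "set st2 \<inter> X = {}"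
    and "\<forall>x\<in>set w. fst x \<notin> X"
  shows "cut_count (stack_matching (st2 @ st1) w) X = length st1"
  using assms
proof (induction w arbitrary: st1 st2)
  case (Cons x w)
  obtain v b where x: "x = (v, b)" by (cases x)
  show ?case
  proof (cases b)
    case True
    then show ?thesis using Cons.IH[of "v # st2" st1] Cons.prems x by simp
  next
    case False
    show ?thesis
    proof (cases st2)
      case Nil
      with Cons.prems x False obtain q st where "st1 = q # st" by (cases st1) auto
      then show ?thesis using Cons.IH[of "[]" st] Cons.prems x False Nil by simp
    next
      case (Cons q st)
      then show ?thesis using Cons.IH[of st st1] Cons.prems x False by simp
    qed
  qed
qed simp

text \<open>Edges closed during \<open>w1\<close> stay inside \<open>X\<close>. After
  \<open>w1\<close> the stack has height \<open>h\<close> by \<open>closes_unique\<close>, and each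
  of its entries yields one cut edge.\<close>

lemma cut_count_stack_matching_prefix:
  assumes "closes (length st) (w1 @ w2)" "closes h w2" "set st \<subseteq> X"
    and "\<forall>x\<in>set w1. fst x \<in> X" "\<forall>x\<in>set w2. fst x \<notin> X"
  shows "cut_count (stack_matching st (w1 @ w2)) X = h"
  using assms
proof (induction w1 arbitrary: st)
  case Nil
  then have "length st = h" using closes_unique by auto
  with Nil cut_count_stack_matching_bottom[of "[]" st w2 X] show ?case by simp
next
  case (Cons x w1)
  obtain v b where x: "x = (v, b)" by (cases x)
  show ?case
  proof (cases b)
    case True
    then show ?thesis using Cons.IH[of "v # st"] Cons.prems x by simp
  next
    case False
    with Cons.prems x obtain q st' where "st = q # st'" by (cases st) auto
    then show ?thesis using Cons.IH[of st'] Cons.prems x False by simp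
  qed
qed

section \<open>Order and degrees of profile words\<close>

lemma set_steps_subset: "set (steps v a b w) \<subseteq> {(v, a < b)} \<union> set w"
  by (auto simp: steps_eq)

lemma fst_profile_word: "x \<in> set (profile_word es vs ys) \<Longrightarrow> fst x \<in> set vs"
proof (induction vs)
  case (Cons v vs)
  then show ?case using set_steps_subset by fastforce
qed simp

lemma sorted_profile_word:
  assumes "sorted_wrt (\<lambda>x y. (pos x :: nat) < pos y) vs"
  shows "sorted (map (\<lambda>x. pos (fst x)) (profile_word es vs ys))"
  using assms
proof (induction vs)
  case (Cons v vs)
  have "pos v \<le> pos (fst x)" if "x \<in> set (profile_word es vs ys)" for x
    using fst_profile_word[OF that] Cons.prems by auto
  with Cons show ?case by (auto simp: steps_eq sorted_append)
qed simp

text \<open>This excludes loops from the matching inside \<open>S\<close>.\<close>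

lemma profile_word_one_direction:
  "distinct vs \<Longrightarrow> (v, True) \<in> set (profile_word es vs ys) \<Longrightarrow>
    (v, False) \<notin> set (profile_word es vs ys)"
proof (induction vs)
  case (Cons u vs)
  then show ?case using fst_profile_word[of _ es vs ys] by (fastforce simp: steps_eq)
qed simp

lemma length_filter_steps:
  "length (filter (\<lambda>x. fst x \<in> X) (steps v a b w)) =
    (if v \<in> X then (b - a) + (a - b) else 0) + length (filter (\<lambda>x. fst x \<in> X) w)"
  by (simp add: steps_eq)

lemma incidences_Int_Cons:
  "v \<notin> set vs \<Longrightarrow> incidences es (X \<inter> set (v # vs)) =
    (if v \<in> X then incidences es {v} else 0) + incidences es (X \<inter> set vs)"
  using incidences_insert[of v "X \<inter> set vs" es] by (simp add: Int_insert_right)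

text \<open>A vertex carries as many letters as the heights on its two sides differ, which is at
  most its degree.\<close>

lemma letters_profile_word_le:
  "distinct vs \<Longrightarrow> length (filter (\<lambda>x. fst x \<in> X) (profile_word es vs ys)) \<le>
    incidences es (X \<inter> set vs)"
proof (induction vs)
  case (Cons v vs)
  then show ?case
    using incidences_Int_Cons[of v vs es X] min_cut_Cons_le[of es v vs ys]
      min_cut_le_Cons[of es vs ys v]
    by (simp add: length_filter_steps del: list.set) linarith
qed simp

text \<open>This splits the word at a vertex, as \<open>cut_count_stack_matching_prefix\<close>
  requires.\<close>

lemma profile_word_append:
  "\<exists>w. profile_word es (us @ vs) ys = w @ profile_word es vs ys \<and> fst ` set w \<subseteq> set us"
proof (induction us)
  case (Cons u us)
  then obtain w where w: "profile_word es (us @ vs) ys = w @ profile_word es vs ys"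
    "fst ` set w \<subseteq> set us" by blast
  let ?a = "min_cut es (u # us @ vs) ys" and ?b = "min_cut es (us @ vs) ys"
  show ?case
    by (rule exI[of _ "replicate (?b - ?a) (u, True) @ replicate (?a - ?b) (u, False) @ w"])
      (use w in \<open>auto simp: steps_eq\<close>)
qed simp

section \<open>Demands between two consecutive intervals\<close>

text \<open>For demands between \<open>S\<close> and \<open>T\<close>, with \<open>A\<close> a
  prefix of \<open>S\<close> and \<open>B\<close> a suffix of \<open>T\<close>, this is the number
  x; with \<open>A\<close> and \<open>B\<close> exchanged it is y.\<close>

definition one_sided_count :: "(nat \<times> nat) list \<Rightarrow> nat set \<Rightarrow> nat set \<Rightarrow> nat" where
  "one_sided_count es A B =
    length (filter (\<lambda>(i, j). (i \<in> A \<and> j \<notin> B) \<or> (j \<in> A \<and> i \<notin> B)) es)"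

lemma one_sided_count_simps [simp]:
  "one_sided_count [] A B = 0"
  "one_sided_count ((i, j) # es) A B =
     (if (i \<in> A \<and> j \<notin> B) \<or> (j \<in> A \<and> i \<notin> B) then 1 else 0) + one_sided_count es A B"
  by (auto simp: one_sided_count_def)

lemma one_sided_count_antimono: "B \<subseteq> B' \<Longrightarrow> one_sided_count es A B' \<le> one_sided_count es A B"
  by (induction es) auto

lemma one_sided_count_mono: "A \<subseteq> A' \<Longrightarrow> one_sided_count es A B \<le> one_sided_count es A' B"
  by (induction es) auto

lemma incidences_empty [simp]: "incidences es {} = 0"
  by (induction es) auto

lemma incidences_mono: "X \<subseteq> Y \<Longrightarrow> incidences es X \<le> incidences es Y"
  by (induction es) auto

definition joins :: "(nat \<times> nat) list \<Rightarrow> nat set \<Rightarrow> nat set \<Rightarrow> bool" where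
  "joins es S T \<longleftrightarrow> (\<forall>(i, j)\<in>set es. i \<in> S \<and> j \<in> T \<or> i \<in> T \<and> j \<in> S)"

text \<open>The cut consists of the edges between \<open>A\<close> and \<open>Q\<close> and those
  between \<open>P\<close> and \<open>B\<close>. Edges between \<open>A\<close> and \<open>B\<close>
  enter both degree sums and cancel, so the degree sums differ by x - y; the additive form avoids
  truncated subtraction.\<close>

lemma cut_count_two_sided:
  assumes "joins es (A \<union> P) (B \<union> Q)" "(A \<union> P) \<inter> (B \<union> Q) = {}" "A \<inter> P = {}" "B \<inter> Q = {}"
  shows "cut_count es (P \<union> Q) = one_sided_count es A B + one_sided_count es B A \<and>
    incidences es A + one_sided_count es B A = incidences es B + one_sided_count es A B"
  using assms(1)
proof (induction es)
  case (Cons e es)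
  obtain i j where e: "e = (i, j)" by (cases e)
  have es: "joins es (A \<union> P) (B \<union> Q)" using Cons.prems by (auto simp: joins_def)
  consider "i \<in> A \<union> P" "j \<in> B \<union> Q" | "i \<in> B \<union> Q" "j \<in> A \<union> P"
    using Cons.prems e by (auto simp: joins_def)
  then show ?case
  proof cases
    case 1
    then have "i \<notin> B" "i \<notin> Q" "j \<notin> A" "j \<notin> P" "i \<in> P \<longleftrightarrow> i \<notin> A" "j \<in> Q \<longleftrightarrow> j \<notin> B"
      using assms(2-4) by blast+
    then show ?thesis using Cons.IH[OF es] by (simp add: e)
  next
    case 2
    then have "j \<notin> B" "j \<notin> Q" "i \<notin> A" "i \<notin> P" "j \<in> P \<longleftrightarrow> j \<notin> A" "i \<in> Q \<longleftrightarrow> i \<notin> B"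
      using assms(2-4) by blast+
    then show ?thesis using Cons.IH[OF es] by (simp add: e)
  qed
qed simp

section \<open>The two matchings for demands between \<open>S\<close> and \<open>T\<close>\<close>

locale bipartite_demands =
  fixes es :: "(nat \<times> nat) list" and ss ts :: "nat list"
  assumes distinct: "distinct (ss @ ts)"
    and joins: "joins es (set ss) (set ts)"
begin

lemma disjoint: "set ss \<inter> set ts = {}"
  using distinct by auto

text \<open>No edge lies inside \<open>T\<close>, so cuts there are degree sums.\<close>

lemma cut_count_insert_right:
  assumes "insert v X \<subseteq> set ts" "v \<notin> X"
  shows "cut_count es (insert v X) = cut_count es X + incidences es {v}"
proof -
  have "\<forall>(i, j)\<in>set es. i \<notin> insert v X \<or> j \<notin> insert v X"
    using joins disjoint assms(1) unfolding joins_def by fast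
  then have "cut_count es (insert v X) = incidences es (insert v X)"
    "cut_count es X = incidences es X"
    by (intro cut_count_eq_incidences; auto)+
  then show ?thesis using incidences_insert[OF assms(2)] by simp
qed

text \<open>All neighbours of \<open>v\<close> lie in \<open>ts\<close>, hence in \<open>X\<close>,
  so every edge at \<open>v\<close> leaves the cut when \<open>v\<close> joins.\<close>

lemma cut_count_insert_left:
  assumes "set ts \<subseteq> X" "v \<in> set ss" "v \<notin> X"
  shows "cut_count es X = cut_count es (insert v X) + incidences es {v}"
proof -
  have "joins es (set ss) (set ts)" by (rule joins)
  then show ?thesis
  proof (induction es)
    case (Cons e es)
    obtain i j where e: "e = (i, j)" by (cases e)
    have ij: "i \<in> set ss \<and> j \<in> X \<and> j \<noteq> v \<or> j \<in> set ss \<and> i \<in> X \<and> i \<noteq> v" "joins es (set ss) (set ts)"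
      using Cons.prems e assms by (auto simp: joins_def)
    show ?case using Cons.IH[OF ij(2)] ij(1) assms(3) e by auto
  qed simp
qed

abbreviation straight :: "(nat \<times> nat) list" where
  "straight \<equiv> straight_matching es (ss @ ts)"

abbreviation lefts :: "(nat \<times> nat) list" where
  "lefts \<equiv> left_matching es ss ts"

lemma profile_word_right:
  assumes "distinct vs" "set vs \<subseteq> set ts"
  shows "length (filter (\<lambda>x. fst x \<in> X) (profile_word es vs [])) = incidences es (X \<inter> set vs)
    \<and> (\<forall>x\<in>set (profile_word es vs []). \<not> snd x)"
  using assms
proof (induction vs)
  case (Cons v vs)
  have "cut_count es (insert v (set vs)) = cut_count es (set vs) + incidences es {v}"
    by (rule cut_count_insert_right) (use Cons.prems in auto)
  then have word: "profile_word es (v # vs) [] =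
      replicate (incidences es {v}) (v, False) @ profile_word es vs []"
    by (simp add: steps_eq)
  have inc: "incidences es (X \<inter> set (v # vs)) =
      (if v \<in> X then incidences es {v} else 0) + incidences es (X \<inter> set vs)"
    by (rule incidences_Int_Cons) (use Cons.prems in simp)
  have IH: "length (filter (\<lambda>x. fst x \<in> X) (profile_word es vs [])) = incidences es (X \<inter> set vs)"
    "\<forall>x\<in>set (profile_word es vs []). \<not> snd x"
    using Cons by simp_all
  show ?case
    unfolding word inc using IH by auto
qed simp

text \<open>Along the line the height rises by the degree at each vertex of \<open>S\<close> and
  falls by the degree at each vertex of \<open>T\<close>. Hence the matching joins \<open>S\<close>
  to \<open>T\<close> and keeps all degrees.\<close>

lemma profile_word_straight:
  assumes "distinct us" "set us \<subseteq> set ss"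
  shows "length (filter (\<lambda>x. fst x \<in> X) (profile_word es (us @ ts) [])) =
      incidences es (X \<inter> set (us @ ts))
    \<and> (\<forall>x\<in>set (profile_word es (us @ ts) []). fst x \<in> (if snd x then set us else set ts))"
  using assms
proof (induction us)
  case Nil
  show ?case
    using profile_word_right[of ts X] fst_profile_word[of _ es ts "[]"] distinct by auto
next
  case (Cons u us)
  have u: "u \<notin> set (us @ ts)" using Cons.prems disjoint by auto
  have "cut_count es (set (us @ ts)) = cut_count es (insert u (set (us @ ts))) + incidences es {u}"
    by (rule cut_count_insert_left) (use Cons.prems u in auto)
  then have word: "profile_word es ((u # us) @ ts) [] =
      replicate (incidences es {u}) (u, True) @ profile_word es (us @ ts) []"
    by (simp add: steps_eq)
  have inc: "incidences es (X \<inter> set ((u # us) @ ts)) =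
      (if u \<in> X then incidences es {u} else 0) + incidences es (X \<inter> set (us @ ts))"
    using incidences_Int_Cons[OF u, of es X] by simp
  have IH: "length (filter (\<lambda>x. fst x \<in> X) (profile_word es (us @ ts) [])) =
      incidences es (X \<inter> set (us @ ts))"
    "\<forall>x\<in>set (profile_word es (us @ ts) []). fst x \<in> (if snd x then set us else set ts)"
    using Cons by simp_all
  show ?case
    unfolding word inc using IH by (auto simp del: set_append simp: set_append[of "replicate _ _"])
qed

lemma cut_count_all: "set ss \<union> set ts \<subseteq> X \<Longrightarrow> cut_count es X = 0"
  using joins by (auto simp: joins_def cut_count_def filter_empty_conv)

lemma closes_straight: "closes (length []) (profile_word es (ss @ ts) [])"
  using closes_profile_word[of es "ss @ ts" "[]"] by (simp add: cut_count_all)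

text \<open>Extending \<open>ss\<close> by all of \<open>ts\<close> gives the whole cycle, which no
  demand leaves, so the minimum at the left end is 0.\<close>

lemma closes_lefts: "closes (length []) (profile_word es ss ts)"
  using closes_profile_word[of es ss ts] min_cut_le[of es ss ts "[]"] by (simp add: cut_count_all)

lemma straight_ends:
  assumes "(q, v) \<in> set straight"
  shows "q \<in> set ss" "v \<in> set ts"
proof -
  have word: "\<forall>x\<in>set (profile_word es (ss @ ts) []). fst x \<in> (if snd x then set ss else set ts)"
    using profile_word_straight[of ss "{}"] distinct by simp
  show "q \<in> set ss" "v \<in> set ts"
    using stack_matching_ends[OF closes_straight assms[unfolded straight_matching_def]] word
    by force+
qed

lemma lefts_ends:
  assumes "(q, v) \<in> set lefts"
  shows "q \<in> set ss" "v \<in> set ss" "q \<noteq> v"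
proof -
  note ends = stack_matching_ends[OF closes_lefts assms[unfolded left_matching_def]]
  show "q \<in> set ss" "v \<in> set ss" using ends fst_profile_word[of _ es ss ts] by force+
  show "q \<noteq> v" using ends profile_word_one_direction[of ss q es ts] distinct by auto
qed

lemma joins_straight: "joins straight (set ss) (set ts)"
  using straight_ends by (auto simp: joins_def)

lemma incidences_straight: "incidences straight X = incidences es X"
proof -
  have "incidences straight X = incidences es (X \<inter> set (ss @ ts))"
    unfolding straight_matching_def using incidences_stack_matching[OF closes_straight, of X]
      profile_word_straight[of ss X] distinct by simp
  also have "\<dots> = incidences es X"
    by (rule incidences_cong) (use joins in \<open>auto simp: joins_def\<close>)
  finally show ?thesis .
qed

lemma incidences_lefts_le: "incidences lefts X \<le> incidences es X"
proof -
  have "incidences lefts X \<le> incidences es (X \<inter> set ss)"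
    unfolding left_matching_def using incidences_stack_matching[OF closes_lefts, of X]
      letters_profile_word_le[of ss X es ts] distinct by simp
  also have "\<dots> \<le> incidences es X"
    by (rule incidences_mono) simp
  finally show ?thesis .
qed

lemma cut_count_lefts:
  assumes "ss = u @ p" "set ps \<inter> set ss = set p"
  shows "cut_count lefts (set ps) = min_cut es p ts"
proof -
  obtain w where w: "profile_word es (u @ p) ts = w @ profile_word es p ts" "fst ` set w \<subseteq> set u"
    using profile_word_append by blast
  have word: "profile_word es ss ts = w @ profile_word es p ts" using w(1) assms(1) by simp
  \<comment> \<open>All ends lie in \<open>ss\<close>, so \<open>ps\<close> has the same cut as
    \<open>p\<close> and, by complementation within \<open>ss\<close>, as the prefix
    \<open>u\<close>.\<close>
  have "cut_count lefts (set ps) = cut_count lefts (set u)"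
    by (rule cut_count_cong) (use lefts_ends assms distinct in fastforce)
  also have "\<dots> = min_cut es p ts"
    unfolding left_matching_def word
  proof (rule cut_count_stack_matching_prefix)
    show "closes (length []) (w @ profile_word es p ts)"
      using closes_lefts unfolding word .
    show "closes (min_cut es p ts) (profile_word es p ts)" by (rule closes_profile_word)
    show "\<forall>x\<in>set (profile_word es p ts). fst x \<notin> set u"
      using fst_profile_word[of _ es p ts] distinct assms(1) by auto
  qed (use w(2) in auto)
  finally show ?thesis .
qed

context
  fixes pos :: "nat \<Rightarrow> nat"
  assumes sorted_pos: "sorted_wrt (\<lambda>x y. pos x < pos y) (ss @ ts)"
begin

lemma straight_ordered: "(q, v) \<in> set straight \<Longrightarrow> pos q \<le> pos v"
  unfolding straight_matching_def
  by (rule stack_matching_ordered[OF closes_straight])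
    (use sorted_profile_word[OF sorted_pos] in auto)

lemma straight_noncrossing:
  "(q, v) \<in> set straight \<Longrightarrow> (q', v') \<in> set straight \<Longrightarrow>
    \<not> (pos q < pos q' \<and> pos q' < pos v \<and> pos v < pos v')"
  unfolding straight_matching_def
  by (rule stack_matching_noncrossing[OF closes_straight])
    (use sorted_profile_word[OF sorted_pos] in auto)

lemma lefts_ordered: "(q, v) \<in> set lefts \<Longrightarrow> pos q \<le> pos v"
  unfolding left_matching_def
  by (rule stack_matching_ordered[OF closes_lefts])
    (use sorted_profile_word[of pos ss] sorted_pos in \<open>auto simp: sorted_wrt_append\<close>)

lemma lefts_noncrossing:
  "(q, v) \<in> set lefts \<Longrightarrow> (q', v') \<in> set lefts \<Longrightarrow>
    \<not> (pos q < pos q' \<and> pos q' < pos v \<and> pos v < pos v')"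
  unfolding left_matching_def
  by (rule stack_matching_noncrossing[OF closes_lefts])
    (use sorted_profile_word[of pos ss] sorted_pos in \<open>auto simp: sorted_wrt_append\<close>)

text \<open>An edge from \<open>u\<close> to \<open>q\<close> and an edge from \<open>p\<close> to
  \<open>w\<close> would cross, since the line reads \<open>u\<close>, \<open>p\<close>,
  \<open>q\<close>, \<open>w\<close>.\<close>

lemma straight_one_sided:
  assumes "ss = u @ p" "ts = q @ w"
  shows "one_sided_count straight (set u) (set w) = 0 \<or>
    one_sided_count straight (set w) (set u) = 0"
proof (rule ccontr)
  assume "\<not> ?thesis"
  then obtain i j i' j' where edges: "(i, j) \<in> set straight" "(i', j') \<in> set straight"
    and ij: "i \<in> set u \<and> j \<notin> set w \<or> j \<in> set u \<and> i \<notin> set w"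
      "i' \<in> set w \<and> j' \<notin> set u \<or> j' \<in> set w \<and> i' \<notin> set u"
    by (auto simp: one_sided_count_def filter_empty_conv)
  have "i \<in> set u" "j \<in> set q" "i' \<in> set p" "j' \<in> set w"
    using straight_ends[OF edges(1)] straight_ends[OF edges(2)] ij disjoint assms by auto
  then have "pos i < pos i'" "pos i' < pos j" "pos j < pos j'"
    using sorted_pos unfolding assms by (auto simp: sorted_wrt_append)
  with straight_noncrossing[OF edges] show False by blast
qed

lemma interval_bounds:
  assumes "ss @ ts = u @ v @ w"
  shows "cut_count straight (set v) \<le> cut_count es (set v) \<and>
    cut_count lefts (set v) \<le> cut_count es (set v) \<and>
    cut_count es (set v) \<le> cut_count straight (set v) + 2 * cut_count lefts (set v)"
proof -
  \<comment> \<open>Either the interval stays on one side, where cuts are degree sums, or it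
    straddles the boundary between \<open>ss\<close> and \<open>ts\<close>.\<close>
  have "(\<exists>x. ss = u @ v @ x) \<or> (\<exists>x. ts = x @ v @ w) \<or> (\<exists>p q. v = p @ q \<and> ss = u @ p \<and> ts = q @ w)"
    using assms by (auto simp: append_eq_append_conv2)
  then consider "set v \<subseteq> set ss \<or> set v \<subseteq> set ts"
    | p q where "v = p @ q" "ss = u @ p" "ts = q @ w" by fastforce
  then show ?thesis
  proof cases
    case 1
    have "cut_count es (set v) = incidences es (set v)"
      by (rule cut_count_eq_incidences) (use joins disjoint 1 in \<open>unfold joins_def, fast\<close>)
    moreover have "cut_count straight (set v) = incidences straight (set v)"
      by (rule cut_count_eq_incidences) (use joins_straight disjoint 1 in \<open>unfold joins_def, fast\<close>)
    ultimately show ?thesis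
      using incidences_straight[of "set v"] incidences_lefts_le[of "set v"]
        cut_count_le_incidences[of lefts "set v"] by linarith
  next
    case 2
    have sets: "set ss = set u \<union> set p" "set ts = set w \<union> set q" "set v = set p \<union> set q"
      "(set u \<union> set p) \<inter> (set w \<union> set q) = {}" "set u \<inter> set p = {}" "set w \<inter> set q = {}"
      using 2 distinct by auto
    note es = cut_count_two_sided[OF joins[unfolded sets(1,2)] sets(4-6)]
    note straight = cut_count_two_sided[OF joins_straight[unfolded sets(1,2)] sets(4-6)]
    have lefts: "cut_count lefts (set v) = min_cut es p ts"
      by (rule cut_count_lefts[OF 2(2)]) (use sets in auto)
    have upper: "min_cut es p ts \<le> cut_count es (set v)"
      unfolding sets(3) 2(3) by (rule min_cut_le)
    \<comment> \<open>\<open>q'\<close> is a prefix of \<open>ts\<close> at which the minimum h is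
      attained.\<close>
    obtain q' w' where ts: "ts = q' @ w'" and h: "min_cut es p ts = cut_count es (set p \<union> set q')"
      using min_cut_attained by blast
    have sets': "set ts = set w' \<union> set q'" "(set u \<union> set p) \<inter> (set w' \<union> set q') = {}"
      "set w' \<inter> set q' = {}"
      using ts 2(2) distinct by auto
    have h': "min_cut es p ts = one_sided_count es (set u) (set w') + one_sided_count es (set w') (set u)"
      using cut_count_two_sided[OF joins[unfolded sets(1) sets'(1)] sets'(2) sets(5) sets'(3)] h
      by simp
    \<comment> \<open>Both are suffixes of \<open>ts\<close>, hence nested. If \<open>w'\<close> is
      the smaller one, x at \<open>w\<close> is at most x at \<open>w'\<close>; otherwise y at
      \<open>w\<close> is at most y at \<open>w'\<close>. Since h is x + y at \<open>w'\<close>, it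
      bounds min x y at \<open>w\<close>.\<close>
    have "set w' \<subseteq> set w \<or> set w \<subseteq> set w'"
      using ts 2(3) by (auto simp: append_eq_append_conv2)
    then have "one_sided_count es (set u) (set w) \<le> min_cut es p ts \<or>
        one_sided_count es (set w) (set u) \<le> min_cut es p ts"
      using one_sided_count_antimono[of "set w'" "set w" es "set u"]
        one_sided_count_mono[of "set w" "set w'" es "set u"] h' by linarith
    \<comment> \<open>For \<open>straight\<close> one of the one-sided counts is 0 and the degrees
      are those of \<open>es\<close>, so its cut is |x - y|. The deficit from x + y is 2 * min x y,
      which two copies of \<open>lefts\<close> cover.\<close>
    then show ?thesis
      using es straight upper lefts straight_one_sided[OF 2(2,3)]
        incidences_straight[of "set u"] incidences_straight[of "set w"]
      unfolding sets(3) by linarith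
  qed
qed

end

end

section \<open>Demands on the cycle\<close>

definition demands :: "'v list \<Rightarrow> (nat \<times> nat) list \<Rightarrow> 'v set multiset" where
  "demands F es = mset (map (\<lambda>(i, j). {F ! i, F ! j}) es)"

definition proper_edges :: "nat \<Rightarrow> (nat \<times> nat) list \<Rightarrow> bool" where
  "proper_edges n es \<longleftrightarrow> (\<forall>(i, j)\<in>set es. i < n \<and> j < n \<and> i \<noteq> j)"

lemma card_doubleton_Int:
  "a \<noteq> b \<Longrightarrow> card ({a, b} \<inter> X) = 1 \<longleftrightarrow> (a \<in> X) \<noteq> (b \<in> X)"
  by (cases "a \<in> X"; cases "b \<in> X") (auto simp: Int_insert_left)

lemma nth_mem_image_iff:
  assumes "distinct F" "i < length F" "X \<subseteq> {..<length F}"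
  shows "F ! i \<in> (!) F ` X \<longleftrightarrow> i \<in> X"
  using assms by (auto simp: nth_eq_iff_index_eq)

lemma cut_size_demands:
  assumes "distinct F" "proper_edges (length F) es" "X \<subseteq> {..<length F}"
  shows "cut_size (demands F es) ((!) F ` X) = cut_count es X"
  using assms(2)
proof (induction es)
  case (Cons e es)
  obtain i j where e: "e = (i, j)" by (cases e)
  have ij: "i < length F" "j < length F" "i \<noteq> j" and es: "proper_edges (length F) es"
    using Cons.prems e by (auto simp: proper_edges_def)
  have "card ({F ! i, F ! j} \<inter> (!) F ` X) = 1 \<longleftrightarrow> (i \<in> X) \<noteq> (j \<in> X)"
    using card_doubleton_Int[of "F ! i" "F ! j"] nth_mem_image_iff[OF assms(1) _ assms(3)] ij
      assms(1) by (simp add: nth_eq_iff_index_eq)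
  then show ?case using Cons.IH[OF es] by (simp add: e demands_def cut_size_def)
qed (simp add: demands_def cut_size_def)

lemma cut_size_plus: "cut_size (H + H') S = cut_size H S + cut_size H' S"
  by (simp add: cut_size_def)

lemma demands_append: "demands F (es @ es') = demands F es + demands F es'"
  by (simp add: demands_def)

lemma repeat_mset_2: "repeat_mset 2 M = M + M"
  by (simp add: multiset_eq_iff)

section \<open>Rotations, segments and crossings\<close>

lemma rotate_via_rotate: "\<exists>k. rotate m xs = rotate k (rotate l xs)"
proof (cases "xs = []")
  case False
  \<comment> \<open>Rotating by \<open>l\<close> another \<open>length xs - 1\<close> times
    completes a multiple of full turns.\<close>
  then have "m + (length xs - 1) * l + l = m + length xs * l"
    by (cases xs) auto
  then have "rotate (m + (length xs - 1) * l) (rotate l xs) = rotate (m + length xs * l) xs"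
    by (simp only: rotate_rotate)
  also have "\<dots> = rotate m xs"
    by (metis mod_mult_self2 rotate_conv_mod)
  finally show ?thesis by metis
qed simp

text \<open>A segment that does not wrap around is an interval of the line; one that does is the
  complement of an interval.\<close>

lemma set_take_rotate:
  "\<exists>u v w. xs = u @ v @ w \<and>
    (set (take k (rotate m xs)) = set v \<or> set (take k (rotate m xs)) = set u \<union> set w)"
proof -
  define a b where "a = take (m mod length xs) xs" and "b = drop (m mod length xs) xs"
  have xs: "xs = a @ b" and rot: "rotate m xs = b @ a"
    by (simp_all add: a_def b_def rotate_drop_take)
  show ?thesis
  proof (cases "k \<le> length b")
    case True
    then have "xs = a @ take k b @ drop k b \<and> set (take k (rotate m xs)) = set (take k b)"
      using xs rot by simp
    then show ?thesis by blast
  next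
    case False
    let ?k = "k - length b"
    have "xs = take ?k a @ drop ?k a @ b \<and>
        set (take k (rotate m xs)) = set (take ?k a) \<union> set b"
      using xs rot False by auto
    then show ?thesis by blast
  qed
qed

lemma subseq_rotateE:
  assumes "subseq ys (rotate m xs)"
  obtains ys1 ys2 where "ys = ys1 @ ys2" "subseq (ys2 @ ys1) xs"
proof -
  define a b where "a = take (m mod length xs) xs" and "b = drop (m mod length xs) xs"
  have xs: "xs = a @ b" and rot: "rotate m xs = b @ a"
    by (simp_all add: a_def b_def rotate_drop_take)
  from assms obtain ys1 ys2 where "ys = ys1 @ ys2" "subseq ys1 b" "subseq ys2 a"
    unfolding rot by (auto simp: subseq_append_iff)
  then show ?thesis using that xs by (metis list_emb_append_mono)
qed

text \<open>Cutting the cycle elsewhere rotates the four ends, which keeps them alternating but may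
  exchange the roles of \<open>e\<close> and \<open>f\<close>. So crossings can be tested on one
  fixed line.\<close>

lemma crossing_linear:
  assumes "crossing F e f"
  obtains a b c d where "subseq [a, b, c, d] (rotate m F)"
    "e = {a, c} \<and> f = {b, d} \<or> f = {a, c} \<and> e = {b, d}"
proof -
  obtain u v x y l where ef: "e = {u, v}" "f = {x, y}" and "subseq [u, x, v, y] (rotate l F)"
    using assms by (auto simp: crossing_def)
  moreover obtain k where "rotate l F = rotate k (rotate m F)" using rotate_via_rotate by blast
  ultimately obtain ys1 ys2 where ys: "[u, x, v, y] = ys1 @ ys2"
    and sub: "subseq (ys2 @ ys1) (rotate m F)"
    by (metis subseq_rotateE)
  have "ys2 @ ys1 \<in> {[u, x, v, y], [x, v, y, u], [v, y, u, x], [y, u, x, v]}"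
    using ys by (auto simp: Cons_eq_append_conv)
  then show ?thesis using sub that ef by (elim insertE emptyE; simp) (metis insert_commute)+
qed

lemma sorted_wrt_subseq: "subseq xs ys \<Longrightarrow> sorted_wrt R ys \<Longrightarrow> sorted_wrt R xs"
proof (induction rule: list_emb.induct)
  case (list_emb_Cons2 x y xs ys)
  then show ?case using list_emb_set[of "(=)" xs ys] by fastforce
qed auto

lemma laminar_demandsI:
  fixes idx :: "'v \<Rightarrow> nat"
  assumes "distinct F" "proper_edges (length F) es"
    and idx: "sorted_wrt (\<lambda>x y. idx x < idx y) (rotate m F)"
    and ordered: "\<And>q v. (q, v) \<in> set es \<Longrightarrow> idx (F ! q) \<le> idx (F ! v)"
    and noncrossing: "\<And>q v q' v'. (q, v) \<in> set es \<Longrightarrow> (q', v') \<in> set es \<Longrightarrow>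
      \<not> (idx (F ! q) < idx (F ! q') \<and> idx (F ! q') < idx (F ! v) \<and> idx (F ! v) < idx (F ! v'))"
  shows "laminar_demands F (demands F es)"
  unfolding laminar_demands_def
proof (intro conjI ballI notI)
  show "demands_on F (demands F es)"
    using assms(1,2) by (auto simp: demands_on_def demands_def proper_edges_def nth_eq_iff_index_eq
        card_insert_if)
next
  fix e f assume "e \<in># demands F es" "f \<in># demands F es" and "crossing F e f"
  then obtain q v q' v' where edges: "(q, v) \<in> set es" "(q', v') \<in> set es"
    and ef: "e = {F ! q, F ! v}" "f = {F ! q', F ! v'}"
    by (auto simp: demands_def)
  from \<open>crossing F e f\<close> obtain a b c d where "subseq [a, b, c, d] (rotate m F)"
    and abcd: "e = {a, c} \<and> f = {b, d} \<or> f = {a, c} \<and> e = {b, d}"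
    by (rule crossing_linear)
  then have less: "idx a < idx b" "idx b < idx c" "idx c < idx d"
    using sorted_wrt_subseq[OF _ idx] by fastforce+
  \<comment> \<open>The orientation from left to right determines which end of each edge is which of
    \<open>a\<close>, \<open>b\<close>, \<open>c\<close>, \<open>d\<close>.\<close>
  note ord = ordered[OF edges(1)] ordered[OF edges(2)]
  from abcd show False
  proof (elim disjE conjE)
    assume "e = {a, c}" "f = {b, d}"
    then have "F ! q = a" "F ! v = c" "F ! q' = b" "F ! v' = d"
      using ef ord less by (auto simp: doubleton_eq_iff)
    then show False using noncrossing[OF edges] less by simp
  next
    assume "f = {a, c}" "e = {b, d}"
    then have "F ! q' = a" "F ! v' = c" "F ! q = b" "F ! v = d"
      using ef ord less by (auto simp: doubleton_eq_iff)
    then show False using noncrossing[OF edges(2,1)] less by simp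
  qed
qed

lemma cut_count_complement:
  assumes "\<forall>(i, j)\<in>set es. i \<in> X \<union> Y \<and> j \<in> X \<union> Y" "X \<inter> Y = {}"
  shows "cut_count es X = cut_count es Y"
  by (rule cut_count_cong) (use assms in fast)

lemma laminar_cover_matchings:
  fixes F :: "'v list"
  assumes F: "distinct F" and es: "proper_edges (length F) es"
    and cyc: "rotate m [0..<length F] = ss @ ts" and joins: "joins es (set ss) (set ts)"
  shows "laminar_cover F (demands F es) (demands F (straight_matching es (ss @ ts)))
    (demands F (left_matching es ss ts @ left_matching es ss ts))"
    and "proper_edges (length F) (straight_matching es (ss @ ts))"
    and "proper_edges (length F) (left_matching es ss ts)"
proof -
  interpret bipartite_demands es ss ts
  proof
    show "distinct (ss @ ts)" unfolding cyc[symmetric] by simp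
  qed (rule joins)
  have set_cyc: "set (ss @ ts) = {..<length F}" unfolding cyc[symmetric] by auto
  have rot: "rotate m F = map ((!) F) (ss @ ts)"
    unfolding cyc[symmetric] rotate_map[symmetric] by (simp add: map_nth)
  \<comment> \<open>The coordinate of a vertex on the line; \<open>idx (F ! x)\<close> plays the
    role of \<open>pos x\<close>.\<close>
  define idx where "idx = the_inv_into {..<length F} ((!) (rotate m F))"
  have "inj_on ((!) (rotate m F)) {..<length F}"
    using F by (auto simp: inj_on_def nth_eq_iff_index_eq)
  then have idx_nth: "idx (rotate m F ! i) = i" if "i < length F" for i
    unfolding idx_def using that by (intro the_inv_into_f_f) auto
  have idx: "sorted_wrt (\<lambda>x y. idx x < idx y) (rotate m F)"
    unfolding sorted_wrt_iff_nth_less by (auto simp: idx_nth)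
  then have pos: "sorted_wrt (\<lambda>x y. idx (F ! x) < idx (F ! y)) (ss @ ts)"
    unfolding rot by (simp only: sorted_wrt_map)
  have proper_straight: "proper_edges (length F) straight"
    using straight_ends set_cyc disjoint by (fastforce simp: proper_edges_def)
  have proper_lefts: "proper_edges (length F) lefts"
    using lefts_ends set_cyc by (fastforce simp: proper_edges_def)
  \<comment> \<open>\<open>interval_bounds\<close> treats intervals, and a complement has the same
    cut in each of the three lists.\<close>
  have bounds: "cut_count straight X \<le> cut_count es X \<and> cut_count lefts X \<le> cut_count es X \<and>
      cut_count es X \<le> cut_count straight X + 2 * cut_count lefts X"
    if uvw: "ss @ ts = u @ v @ w" and X: "X = set v \<or> X = set u \<union> set w" for u v w X
  proof -
    have parts: "set v \<union> (set u \<union> set w) = {..<length F}" "set v \<inter> (set u \<union> set w) = {}"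
      using set_cyc distinct unfolding uvw by auto
    have "cut_count E (set v) = cut_count E X" if "proper_edges (length F) E" for E
      using X cut_count_complement[of E "set v" "set u \<union> set w"] that parts
      by (auto simp: proper_edges_def)
    then show ?thesis
      using interval_bounds[OF pos uvw] es proper_straight proper_lefts by metis
  qed
  have segment: "\<exists>X\<subseteq>{..<length F}. S = (!) F ` X \<and>
      cut_count straight X \<le> cut_count es X \<and> cut_count lefts X \<le> cut_count es X \<and>
      cut_count es X \<le> cut_count straight X + 2 * cut_count lefts X"
    if seg: "contiguous_segment F S" for S
  proof -
    obtain k l where "S = set (take k (rotate l F))"
      using seg by (auto simp: contiguous_segment_def)
    moreover obtain l' where "rotate l F = rotate l' (rotate m F)"
      using rotate_via_rotate by blast
    ultimately have S: "S = set (take k (rotate l' (rotate m F)))" by simp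
    let ?X = "set (take k (rotate l' (ss @ ts)))"
    obtain u v w where "ss @ ts = u @ v @ w" "?X = set v \<or> ?X = set u \<union> set w"
      using set_take_rotate[of "ss @ ts" k l'] by blast
    note bounds[OF this]
    moreover have "S = (!) F ` ?X"
      unfolding S rot rotate_map take_map by (rule set_map)
    moreover have "?X \<subseteq> {..<length F}"
      unfolding set_cyc[symmetric] using set_take_subset[of k "rotate l' (ss @ ts)"]
      by (simp only: set_rotate)
    ultimately show ?thesis by (intro exI[of _ ?X] conjI) simp_all
  qed
  have "laminar_demands F (demands F straight)"
    by (rule laminar_demandsI[OF F proper_straight idx])
      (use straight_ordered[OF pos] straight_noncrossing[OF pos] in blast)+
  moreover have "laminar_demands F (demands F (lefts @ lefts))"
  proof (rule laminar_demandsI[OF F _ idx])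
    show "proper_edges (length F) (lefts @ lefts)"
      using proper_lefts by (auto simp: proper_edges_def)
  qed (use lefts_ordered[OF pos] lefts_noncrossing[OF pos] in auto)
  moreover have "cut_size (demands F straight) S \<le> cut_size (demands F es) S \<and>
      cut_size (demands F lefts) S \<le> cut_size (demands F es) S \<and>
      cut_size (demands F es) S \<le> cut_size (demands F straight) S + 2 * cut_size (demands F lefts) S"
    if "contiguous_segment F S" for S
    using segment[OF that] cut_size_demands[OF F es] cut_size_demands[OF F proper_straight]
      cut_size_demands[OF F proper_lefts] by fastforce
  then have "dominated_by F (demands F straight) (demands F es)"
    "dominated_by F (demands F (lefts @ lefts)) (repeat_mset 2 (demands F es))"
    "dominated_by F (demands F es) (demands F straight + demands F (lefts @ lefts))"
    unfolding dominated_by_def repeat_mset_2 demands_append cut_size_plus by (force simp: mult_2)+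
  ultimately show "laminar_cover F (demands F es) (demands F straight) (demands F (lefts @ lefts))"
    by (simp add: laminar_cover_def)
  show "proper_edges (length F) straight" "proper_edges (length F) lefts"
    by (fact proper_straight proper_lefts)+
qed

section \<open>The program\<close>

text \<open>
  The equations for the weakest precondition \<open>wp\<close> let the simplifier execute a function body
  symbolically up to its next call.
\<close>

definition wp :: "prog \<Rightarrow> btree list \<Rightarrow> expr \<Rightarrow> (btree \<Rightarrow> nat \<Rightarrow> bool) \<Rightarrow> bool" where
  "wp P vs e Q \<longleftrightarrow> (\<exists>b t. eval P vs e b t \<and> Q b t)"

definition wps :: "prog \<Rightarrow> btree list \<Rightarrow> expr list \<Rightarrow> (btree list \<Rightarrow> nat \<Rightarrow> bool) \<Rightarrow> bool" where
  "wps P vs es Q \<longleftrightarrow> (\<exists>bs t. evals P vs es bs t \<and> Q bs t)"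

inductive_simps eval_Arg_iff: "eval P vs (Arg i) b t"
inductive_simps eval_Empty_iff: "eval P vs Empty b t"
inductive_simps eval_Pairing_iff: "eval P vs (Pairing e1 e2) b t"
inductive_simps eval_Left_iff: "eval P vs (Left e) b t"
inductive_simps eval_Right_iff: "eval P vs (Right e) b t"
inductive_simps eval_Cond_iff: "eval P vs (Cond e e1 e2) b t"
inductive_simps eval_Call_iff: "eval P vs (Call f es) b t"
inductive_simps evals_Nil_iff: "evals P vs [] bs t"
inductive_simps evals_Cons_iff: "evals P vs (e # es) bs t"

lemma wp_simps:
  "wp P vs (Arg i) Q \<longleftrightarrow> i < length vs \<and> Q (vs ! i) 1"
  "wp P vs Empty Q \<longleftrightarrow> Q Leaf 1"
  "wp P vs (Pairing e1 e2) Q \<longleftrightarrow> wp P vs e1 (\<lambda>a s. wp P vs e2 (\<lambda>b t. Q (Node a b) (s + t + 1)))"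
  "wp P vs (Left e) Q \<longleftrightarrow> wp P vs e (\<lambda>a s. Q (left_of a) (s + 1))"
  "wp P vs (Right e) Q \<longleftrightarrow> wp P vs e (\<lambda>a s. Q (right_of a) (s + 1))"
  "wp P vs (Cond e e1 e2) Q \<longleftrightarrow>
     wp P vs e (\<lambda>a s. wp P vs (if a = Leaf then e2 else e1) (\<lambda>b t. Q b (s + t + 1)))"
  "wp P vs (Call f es) Q \<longleftrightarrow>
     wps P vs es (\<lambda>ws s. f < length P \<and> wp P ws (P ! f) (\<lambda>b t. Q b (s + t + 1)))"
  "wps P vs [] R \<longleftrightarrow> R [] 0"
  "wps P vs (e # es) R \<longleftrightarrow> wp P vs e (\<lambda>a s. wps P vs es (\<lambda>as t. R (a # as) (s + t)))"
  unfolding wp_def wps_def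
          apply (simp add: eval_Arg_iff)
         apply (simp add: eval_Empty_iff)
        apply (simp add: eval_Pairing_iff, blast)
       apply (simp add: eval_Left_iff, fastforce)
      apply (simp add: eval_Right_iff, fastforce)
     apply (simp add: eval_Cond_iff split: if_split, blast)
    apply (simp add: eval_Call_iff, blast)
   apply (simp add: evals_Nil_iff)
  apply (simp add: evals_Cons_iff, blast)
  done

text \<open>The result is exact, but \<open>T\<close> is only an upper bound, which permits round
  and generous constants.\<close>

definition computes :: "prog \<Rightarrow> nat \<Rightarrow> btree list \<Rightarrow> btree \<Rightarrow> nat \<Rightarrow> bool" where
  "computes P f vs b T \<longleftrightarrow> wp P vs (P ! f) (\<lambda>b' t. b' = b \<and> t \<le> T)"

lemma wp_call:
  assumes "computes P f vs b T" and "\<And>t. t \<le> T \<Longrightarrow> Q b t"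
  shows "wp P vs (P ! f) Q"
  using assms by (auto simp: computes_def wp_def)

text \<open>The argument of \<open>Call\<close> is the position of the called body in the list \<open>program\<close>.\<close>

definition main_body :: expr where
  "main_body =
    Call 1 [Right (Right (Arg 0)), Right (Left (Right (Arg 0))),
      Call 12 [Left (Left (Right (Arg 0))), Call 10 [Left (Arg 0), Empty]]]"

text \<open>Expressions have no local bindings, so the second copy of the left matching is computed
  afresh.\<close>

definition cover_body :: expr where
  "cover_body =
    Pairing (Call 9 [Empty, Call 8 [Arg 0, Arg 2, Empty]])
      (Call 11 [
        Call 9 [Empty, Call 8 [Arg 0, Call 13 [Arg 1, Arg 2], Call 14 [Arg 1, Arg 2]]],
        Call 9 [Empty, Call 8 [Arg 0, Call 13 [Arg 1, Arg 2], Call 14 [Arg 1, Arg 2]]]])"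

definition eq_body :: expr where
  "eq_body =
    Cond (Arg 0)
      (Cond (Arg 1) (Call 2 [Right (Arg 0), Right (Arg 1)]) Empty)
      (Cond (Arg 1) Empty (Pairing Empty Empty))"

definition mem_body :: expr where
  "mem_body =
    Cond (Arg 1)
      (Cond (Call 2 [Arg 0, Left (Arg 1)]) (Pairing Empty Empty) (Call 3 [Arg 0, Right (Arg 1)]))
      Empty"

definition cut_body :: expr where
  "cut_body =
    Cond (Arg 0)
      (Cond (Call 3 [Left (Left (Arg 0)), Arg 1])
        (Cond (Call 3 [Right (Left (Arg 0)), Arg 1])
          (Call 4 [Right (Arg 0), Arg 1])
          (Pairing Empty (Call 4 [Right (Arg 0), Arg 1])))
        (Cond (Call 3 [Right (Left (Arg 0)), Arg 1])
          (Pairing Empty (Call 4 [Right (Arg 0), Arg 1]))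
          (Call 4 [Right (Arg 0), Arg 1])))
      Empty"

definition min_body :: expr where
  "min_body =
    Cond (Arg 0)
      (Cond (Arg 1) (Pairing Empty (Call 5 [Right (Arg 0), Right (Arg 1)])) Empty)
      Empty"

definition min_cut_body :: expr where
  "min_cut_body =
    Cond (Arg 2)
      (Call 5 [Call 4 [Arg 0, Arg 1],
        Call 6 [Arg 0, Pairing (Left (Arg 2)) (Arg 1), Right (Arg 2)]])
      (Call 4 [Arg 0, Arg 1])"

definition steps_body :: expr where
  "steps_body =
    Cond (Arg 1)
      (Cond (Arg 2)
        (Call 7 [Arg 0, Right (Arg 1), Right (Arg 2), Arg 3])
        (Pairing (Pairing (Arg 0) Empty) (Call 7 [Arg 0, Right (Arg 1), Empty, Arg 3])))
      (Cond (Arg 2)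
        (Pairing (Pairing (Arg 0) (Pairing Empty Empty))
          (Call 7 [Arg 0, Empty, Right (Arg 2), Arg 3]))
        (Arg 3))"

definition profile_word_body :: expr where
  "profile_word_body =
    Cond (Arg 1)
      (Call 7 [Left (Arg 1), Call 6 [Arg 0, Arg 1, Arg 2], Call 6 [Arg 0, Right (Arg 1), Arg 2],
        Call 8 [Arg 0, Right (Arg 1), Arg 2]])
      Empty"

text \<open>On an empty stack both projections return \<open>Leaf\<close>, which encodes the number
  0 as well as the empty list; this is the origin of the default case of
  \<open>stack_matching\<close>.\<close>

definition stack_matching_body :: expr where
  "stack_matching_body =
    Cond (Arg 1)
      (Cond (Right (Left (Arg 1)))
        (Call 9 [Pairing (Left (Left (Arg 1))) (Arg 0), Right (Arg 1)])
        (Pairing (Pairing (Left (Arg 0)) (Left (Left (Arg 1))))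
          (Call 9 [Right (Arg 0), Right (Arg 1)])))
      Empty"

definition upt_body :: expr where
  "upt_body =
    Cond (Arg 0)
      (Pairing (Arg 1) (Call 10 [Right (Arg 0), Pairing Empty (Arg 1)]))
      Empty"

definition append_body :: expr where
  "append_body =
    Cond (Arg 0)
      (Pairing (Left (Arg 0)) (Call 11 [Right (Arg 0), Arg 1]))
      (Arg 1)"

definition rotate_body :: expr where
  "rotate_body =
    Cond (Arg 0)
      (Call 12 [Right (Arg 0), Cond (Arg 1)
         (Call 11 [Right (Arg 1), Pairing (Left (Arg 1)) Empty]) Empty])
      (Arg 1)"

definition take_body :: expr where
  "take_body =
    Cond (Arg 0)
      (Cond (Arg 1) (Pairing (Left (Arg 1)) (Call 13 [Right (Arg 0), Right (Arg 1)])) Empty)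
      Empty"

definition drop_body :: expr where
  "drop_body =
    Cond (Arg 0)
      (Cond (Arg 1) (Call 14 [Right (Arg 0), Right (Arg 1)]) Empty)
      (Arg 1)"

definition program :: prog where
  "program =
    [main_body, cover_body, eq_body, mem_body, cut_body, min_body, min_cut_body, steps_body,
     profile_word_body, stack_matching_body, upt_body, append_body, rotate_body, take_body,
     drop_body]"

lemma program_nth:
  "program ! 0 = main_body" "program ! Suc 0 = cover_body" "program ! 2 = eq_body"
  "program ! 3 = mem_body" "program ! 4 = cut_body" "program ! 5 = min_body"
  "program ! 6 = min_cut_body" "program ! 7 = steps_body" "program ! 8 = profile_word_body"
  "program ! 9 = stack_matching_body" "program ! 10 = upt_body" "program ! 11 = append_body"
  "program ! 12 = rotate_body" "program ! 13 = take_body" "program ! 14 = drop_body"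
  by (simp_all add: program_def)

lemma length_program: "length program = 15"
  by (simp add: program_def)

definition enc_list :: "('a \<Rightarrow> btree) \<Rightarrow> 'a list \<Rightarrow> btree" where
  "enc_list f xs = foldr (\<lambda>x. Node (f x)) xs Leaf"

lemma enc_list_simps [simp]:
  "enc_list f [] = Leaf"
  "enc_list f (x # xs) = Node (f x) (enc_list f xs)"
  by (simp_all add: enc_list_def)

lemma enc_list_eq_Leaf [simp]: "enc_list f xs = Leaf \<longleftrightarrow> xs = []"
  by (cases xs) auto

lemma enc_nat_eq_Leaf [simp]: "enc_nat n = Leaf \<longleftrightarrow> n = 0"
  by (cases n) auto

definition enc_bool :: "bool \<Rightarrow> btree" where
  "enc_bool b = (if b then Node Leaf Leaf else Leaf)"

lemma enc_bool_eq_Leaf [simp]: "enc_bool b = Leaf \<longleftrightarrow> \<not> b"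
  by (simp add: enc_bool_def)

fun enc_edge :: "nat \<times> nat \<Rightarrow> btree" where
  "enc_edge (i, j) = Node (enc_nat i) (enc_nat j)"

fun enc_letter :: "nat \<times> bool \<Rightarrow> btree" where
  "enc_letter (v, b) = Node (enc_nat v) (enc_bool b)"

lemma enc_edges_eq: "enc_edges es = enc_list enc_edge es"
  by (induction es rule: enc_edges.induct) auto

abbreviation "enc_nats \<equiv> enc_list enc_nat"
abbreviation "enc_word \<equiv> enc_list enc_letter"

section \<open>Correctness and running time of the functions\<close>

lemma computes_eq: "computes program 2 [enc_nat i, enc_nat j] (enc_bool (i = j)) (20 * (i + 1))"
proof (induction i arbitrary: j)
  case 0
  show ?case
    unfolding computes_def program_nth eq_body_def
    by (cases j) (simp_all add: wp_simps enc_bool_def)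
next
  case (Suc i)
  show ?case
  proof (cases j)
    case 0
    then show ?thesis
      unfolding computes_def program_nth eq_body_def by (simp add: wp_simps enc_bool_def)
  next
    case [simp]: (Suc j')
    show ?thesis
      unfolding computes_def program_nth eq_body_def
      by (simp add: wp_simps length_program) (rule wp_call[OF Suc.IH], simp)
  qed
qed

lemma computes_mono: "computes P f vs b T \<Longrightarrow> T \<le> T' \<Longrightarrow> computes P f vs b T'"
  by (auto simp: computes_def wp_def)

text \<open>A single \<open>N\<close> bounds vertex numbers, list lengths and the number of demands.
  The bound is the number of iterations times the cost of one, and so are \<open>cut_time\<close>,
  \<open>min_cut_time\<close> and \<open>profile_word_time\<close>.\<close>

definition mem_time :: "nat \<Rightarrow> nat" where
  "mem_time N = (N + 1) * (20 * (N + 1) + 20)"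

lemma computes_mem:
  assumes "v \<le> N" "length xs \<le> N"
  shows "computes program 3 [enc_nat v, enc_nats xs] (enc_bool (v \<in> set xs)) (mem_time N)"
proof -
  \<comment> \<open>The induction needs a bound that grows with the list; it is relaxed to
    \<open>N\<close> afterwards.\<close>
  have "computes program 3 [enc_nat v, enc_nats xs] (enc_bool (v \<in> set xs))
    ((length xs + 1) * (20 * (N + 1) + 20))"
  proof (induction xs)
    case Nil
    show ?case
      unfolding computes_def program_nth mem_body_def by (simp add: wp_simps enc_bool_def)
  next
    case (Cons x xs)
    show ?case
      unfolding computes_def program_nth mem_body_def
      apply (simp add: wp_simps length_program)
      apply (rule wp_call[OF computes_eq])
      apply (cases "v = x")
      using assms(1) apply (simp add: wp_simps enc_bool_def)
      apply (simp add: wp_simps length_program)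
      apply (rule wp_call[OF Cons.IH])
      using assms(1) apply simp
      done
  qed
  then show ?thesis
    by (rule computes_mono) (use assms(2) in \<open>unfold mem_time_def, intro mult_right_mono; simp\<close>)
qed

definition cut_time :: "nat \<Rightarrow> nat" where
  "cut_time N = (N + 1) * (2 * mem_time N + 40)"

lemma computes_cut:
  assumes "\<forall>(i, j)\<in>set es. i \<le> N \<and> j \<le> N" "length xs \<le> N" "length es \<le> N"
  shows "computes program 4 [enc_list enc_edge es, enc_nats xs] (enc_nat (cut_count es (set xs)))
    (cut_time N)"
proof -
  have "computes program 4 [enc_list enc_edge es, enc_nats xs] (enc_nat (cut_count es (set xs)))
    ((length es + 1) * (2 * mem_time N + 40))"
    using assms(1)
  proof (induction es)
    case Nil
    show ?case
      unfolding computes_def program_nth cut_body_def by (simp add: wp_simps)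
  next
    case (Cons e es)
    obtain i j where [simp]: "e = (i, j)" by (cases e)
    have ij: "i \<le> N" "j \<le> N" using Cons.prems by auto
    have IH: "computes program 4 [enc_list enc_edge es, enc_nats xs]
      (enc_nat (cut_count es (set xs))) ((length es + 1) * (2 * mem_time N + 40))"
      using Cons by auto
    show ?case
      unfolding computes_def program_nth cut_body_def
      apply (simp add: wp_simps length_program del: cut_count_simps)
      apply (rule wp_call[OF computes_mem[OF ij(1) assms(2)]])
      apply (cases "i \<in> set xs"; cases "j \<in> set xs";
        simp add: wp_simps length_program del: cut_count_simps;
        rule wp_call[OF computes_mem[OF ij(2) assms(2)]];
        simp add: wp_simps length_program del: cut_count_simps;
        rule wp_call[OF IH]; simp)
      done
  qed
  then show ?thesis
    by (rule computes_mono) (use assms(3) in \<open>unfold cut_time_def, intro mult_right_mono; simp\<close>)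
qed

lemma computes_min:
  "computes program 5 [enc_nat a, enc_nat b] (enc_nat (min a b)) (20 * (a + 1))"
proof (induction a arbitrary: b)
  case 0
  show ?case
    unfolding computes_def program_nth min_body_def by (simp add: wp_simps)
next
  case (Suc a)
  show ?case
  proof (cases b)
    case 0
    then show ?thesis
      unfolding computes_def program_nth min_body_def by (simp add: wp_simps)
  next
    case [simp]: (Suc b')
    show ?thesis
      unfolding computes_def program_nth min_body_def
      by (simp add: wp_simps length_program) (rule wp_call[OF Suc.IH], simp)
  qed
qed

lemma cut_count_le_length: "cut_count es X \<le> length es"
  by (simp add: cut_count_def)

text \<open>Heights are written in unary, so this bounds the time for taking minima and for emitting
  letters.\<close>

lemma min_cut_le_length: "min_cut es xs ys \<le> length es"
  by (induction es xs ys rule: min_cut.induct) (auto simp: cut_count_le_length min.coboundedI1)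

definition min_cut_time :: "nat \<Rightarrow> nat" where
  "min_cut_time N = (N + 1) * (cut_time N + 20 * (N + 1) + 40)"

lemma computes_min_cut:
  assumes "\<forall>(i, j)\<in>set es. i \<le> N \<and> j \<le> N" "length es \<le> N" "length xs + length ys \<le> N"
  shows "computes program 6 [enc_list enc_edge es, enc_nats xs, enc_nats ys]
    (enc_nat (min_cut es xs ys)) (min_cut_time N)"
proof -
  have "computes program 6 [enc_list enc_edge es, enc_nats xs, enc_nats ys]
    (enc_nat (min_cut es xs ys)) ((length ys + 1) * (cut_time N + 20 * (N + 1) + 40))"
    using assms(3)
  proof (induction ys arbitrary: xs)
    case Nil
    have cut: "computes program 4 [enc_list enc_edge es, enc_nats xs]
      (enc_nat (cut_count es (set xs))) (cut_time N)"
      using computes_cut[OF assms(1) _ assms(2)] Nil by simp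
    show ?case
      unfolding computes_def program_nth min_cut_body_def
      by (simp add: wp_simps length_program) (rule wp_call[OF cut], simp)
  next
    case (Cons y ys)
    have cut: "computes program 4 [enc_list enc_edge es, enc_nats xs]
      (enc_nat (cut_count es (set xs))) (cut_time N)"
      using computes_cut[OF assms(1) _ assms(2)] Cons.prems by simp
    have IH: "computes program 6 [enc_list enc_edge es, enc_nats (y # xs), enc_nats ys]
      (enc_nat (min_cut es (y # xs) ys)) ((length ys + 1) * (cut_time N + 20 * (N + 1) + 40))"
      by (rule Cons.IH) (use Cons.prems in simp)
    \<comment> \<open>The time bound in \<open>computes_min\<close> depends on the first argument
      only.\<close>
    have le: "cut_count es (set xs) \<le> N"
      using cut_count_le_length[of es "set xs"] assms(2) by linarith
    show ?case
      unfolding computes_def program_nth min_cut_body_def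
      apply (simp add: wp_simps length_program)
      apply (rule wp_call[OF cut])
      apply (rule wp_call[OF IH[simplified]])
      apply (rule wp_call[OF computes_min])
      using le apply simp
      done
  qed
  then show ?thesis
    by (rule computes_mono)
      (use assms(3) in \<open>unfold min_cut_time_def, intro mult_right_mono; simp\<close>)
qed

lemma computes_steps:
  "computes program 7 [enc_nat v, enc_nat a, enc_nat b, enc_word w] (enc_word (steps v a b w))
    (30 * (a + b + 1))"
proof (induction v a b w rule: steps.induct)
  case (1 v w)
  show ?case
    unfolding computes_def program_nth steps_body_def by (simp add: wp_simps)
next
  case (2 v b w)
  show ?case
    unfolding computes_def program_nth steps_body_def
    by (simp add: wp_simps length_program)
      (rule wp_call[OF 2[simplified]], simp add: enc_bool_def)
next
  case (3 v a w)
  show ?case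
    unfolding computes_def program_nth steps_body_def
    by (simp add: wp_simps length_program)
      (rule wp_call[OF 3[simplified]], simp add: enc_bool_def)
next
  case (4 v a b w)
  show ?case
    unfolding computes_def program_nth steps_body_def
    by (simp add: wp_simps length_program) (rule wp_call[OF 4[simplified]], simp)
qed

definition profile_word_time :: "nat \<Rightarrow> nat" where
  "profile_word_time N = (N + 1) * (2 * min_cut_time N + 30 * (2 * N + 1) + 40)"

lemma computes_profile_word:
  assumes "\<forall>(i, j)\<in>set es. i \<le> N \<and> j \<le> N" "length es \<le> N" "length vs + length ys \<le> N"
  shows "computes program 8 [enc_list enc_edge es, enc_nats vs, enc_nats ys]
    (enc_word (profile_word es vs ys)) (profile_word_time N)"
proof -
  have "computes program 8 [enc_list enc_edge es, enc_nats vs, enc_nats ys]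
    (enc_word (profile_word es vs ys))
    ((length vs + 1) * (2 * min_cut_time N + 30 * (2 * N + 1) + 40))"
    using assms(3)
  proof (induction vs)
    case Nil
    show ?case
      unfolding computes_def program_nth profile_word_body_def by (simp add: wp_simps)
  next
    case (Cons v vs)
    have h1: "computes program 6 [enc_list enc_edge es, enc_nats (v # vs), enc_nats ys]
      (enc_nat (min_cut es (v # vs) ys)) (min_cut_time N)"
      by (rule computes_min_cut) (use assms Cons.prems in auto)
    have h2: "computes program 6 [enc_list enc_edge es, enc_nats vs, enc_nats ys]
      (enc_nat (min_cut es vs ys)) (min_cut_time N)"
      by (rule computes_min_cut) (use assms Cons.prems in auto)
    have IH: "computes program 8 [enc_list enc_edge es, enc_nats vs, enc_nats ys]
      (enc_word (profile_word es vs ys))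
      ((length vs + 1) * (2 * min_cut_time N + 30 * (2 * N + 1) + 40))"
      by (rule Cons.IH) (use Cons.prems in simp)
    have le: "min_cut es (v # vs) ys \<le> N" "min_cut es vs ys \<le> N"
      using min_cut_le_length assms(2) le_trans by blast+
    show ?case
      unfolding computes_def program_nth profile_word_body_def
      apply (simp add: wp_simps length_program)
      apply (rule wp_call[OF h1[simplified]])
      apply (rule wp_call[OF h2])
      apply (rule wp_call[OF IH])
      apply (rule wp_call[OF computes_steps])
      using le apply simp
      done
  qed
  then show ?thesis
    by (rule computes_mono)
      (use assms(3) in \<open>unfold profile_word_time_def, intro mult_right_mono; simp\<close>)
qed

lemma computes_stack_matching:
  "computes program 9 [enc_nats st, enc_word w] (enc_list enc_edge (stack_matching st w))
    (30 * (length w + 1))"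
proof (induction st w rule: stack_matching.induct)
  case (1 st)
  show ?case
    unfolding computes_def program_nth stack_matching_body_def by (simp add: wp_simps)
next
  case (2 st v w)
  show ?case
    unfolding computes_def program_nth stack_matching_body_def
    by (simp add: wp_simps length_program)
      (rule wp_call[OF 2[simplified]], simp)
next
  case (3 v w)
  show ?case
    unfolding computes_def program_nth stack_matching_body_def
    by (simp add: wp_simps length_program)
      (rule wp_call[OF 3[simplified]], simp)
next
  case (4 q st v w)
  show ?case
    unfolding computes_def program_nth stack_matching_body_def
    by (simp add: wp_simps length_program)
      (rule wp_call[OF 4[simplified]], simp)
qed

lemma computes_upt:
  "computes program 10 [enc_nat c, enc_nat i] (enc_nats [i..<i + c]) (20 * (c + 1))"
proof (induction c arbitrary: i)
  case 0
  show ?case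
    unfolding computes_def program_nth upt_body_def by (simp add: wp_simps)
next
  case (Suc c)
  show ?case
    unfolding computes_def program_nth upt_body_def
    apply (simp add: wp_simps length_program del: upt_Suc)
    apply (rule wp_call[OF Suc.IH[of "Suc i", unfolded enc_nat.simps]])
    apply (simp add: upt_conv_Cons del: upt_Suc)
    done
qed

lemma computes_append:
  "computes program 11 [enc_list f xs, enc_list f ys] (enc_list f (xs @ ys)) (20 * (length xs + 1))"
proof (induction xs)
  case Nil
  show ?case
    unfolding computes_def program_nth append_body_def by (simp add: wp_simps)
next
  case (Cons x xs)
  show ?case
    unfolding computes_def program_nth append_body_def
    by (simp add: wp_simps length_program) (rule wp_call[OF Cons.IH], simp)
qed

lemma computes_rotate:
  "computes program 12 [enc_nat m, enc_list f xs] (enc_list f (rotate m xs))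
    ((m + 1) * (20 * (length xs + 1) + 40))"
proof (induction m arbitrary: xs)
  case 0
  show ?case
    unfolding computes_def program_nth rotate_body_def by (simp add: wp_simps)
next
  case (Suc m)
  show ?case
  proof (cases xs)
    case Nil
    show ?thesis
      unfolding computes_def program_nth rotate_body_def Nil
      by (simp add: wp_simps length_program) (rule wp_call[OF Suc.IH[of "[]", simplified]], simp)
  next
    case (Cons x xs')
    show ?thesis
      unfolding computes_def program_nth rotate_body_def Cons
      apply (simp add: wp_simps length_program)
      apply (rule wp_call[OF computes_append[of f xs' "[x]", simplified]])
      apply (rule wp_call[OF Suc.IH[of "xs' @ [x]"]])
      apply (simp add: rotate1_rotate_swap)
      done
  qed
qed

lemma computes_take:
  "computes program 13 [enc_nat k, enc_list f xs] (enc_list f (take k xs)) (20 * (k + 1))"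
proof (induction k arbitrary: xs)
  case 0
  show ?case
    unfolding computes_def program_nth take_body_def by (simp add: wp_simps)
next
  case (Suc k)
  show ?case
    unfolding computes_def program_nth take_body_def
    by (cases xs; simp add: wp_simps length_program) (rule wp_call[OF Suc.IH], simp)
qed

lemma computes_drop:
  "computes program 14 [enc_nat k, enc_list f xs] (enc_list f (drop k xs)) (20 * (k + 1))"
proof (induction k arbitrary: xs)
  case 0
  show ?case
    unfolding computes_def program_nth drop_body_def by (simp add: wp_simps)
next
  case (Suc k)
  show ?case
    unfolding computes_def program_nth drop_body_def
    by (cases xs; simp add: wp_simps length_program) (rule wp_call[OF Suc.IH], simp)
qed

text \<open>Both heights at a vertex lie between 0 and the number of demands, and so does their
  difference.\<close>

lemma length_profile_word: "length (profile_word es vs ys) \<le> length vs * length es"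
proof (induction vs)
  case (Cons v vs)
  have "(b - a) + (a - b) \<le> length es" if "a \<le> length es" "b \<le> length es" for a b :: nat
    using that by simp
  from this[OF min_cut_le_length min_cut_le_length, of "v # vs" ys vs ys] Cons
  show ?case by (simp add: steps_eq)
qed simp

lemma length_stack_matching: "length (stack_matching st w) \<le> length w"
  by (induction st w rule: stack_matching.induct) auto

definition cover_time :: "nat \<Rightarrow> nat" where
  "cover_time N = 3 * profile_word_time N + 30 * (N * N + 1) * 3 + 20 * (N + 1) * 4
     + 20 * (N * N + 1) + 200"

lemma computes_cover:
  assumes "\<forall>(i, j)\<in>set es. i \<le> N \<and> j \<le> N" "length es \<le> N" "length cyc \<le> N" "k \<le> N"
  shows "computes program (Suc 0) [enc_list enc_edge es, enc_nat k, enc_nats cyc]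
    (Node (enc_list enc_edge (straight_matching es cyc))
      (enc_list enc_edge (left_matching es (take k cyc) (drop k cyc) @
          left_matching es (take k cyc) (drop k cyc)))) (cover_time N)"
proof -
  have word1: "computes program 8 [enc_list enc_edge es, enc_nats cyc, enc_nats []]
    (enc_word (profile_word es cyc [])) (profile_word_time N)"
    by (rule computes_profile_word) (use assms in auto)
  have word2: "computes program 8
    [enc_list enc_edge es, enc_nats (take k cyc), enc_nats (drop k cyc)]
    (enc_word (profile_word es (take k cyc) (drop k cyc))) (profile_word_time N)"
    by (rule computes_profile_word) (use assms in auto)
  have len1: "length (profile_word es cyc []) \<le> N * N"
    using length_profile_word[of es cyc "[]"] mult_mono[OF assms(3,2)] by simp
  have "length (take k cyc) \<le> N" using assms(3) by simp
  then have len2: "length (profile_word es (take k cyc) (drop k cyc)) \<le> N * N"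
    using length_profile_word[of es "take k cyc" "drop k cyc"]
      mult_mono[of "length (take k cyc)" N "length es" N] assms(2) by linarith
  have len3: "length (left_matching es (take k cyc) (drop k cyc)) \<le> N * N"
    using len2 length_stack_matching le_trans unfolding left_matching_def by blast
  have match1: "computes program 9 [Leaf, enc_word (profile_word es cyc [])]
      (enc_list enc_edge (straight_matching es cyc)) (30 * (N * N + 1))"
    using computes_mono[OF computes_stack_matching[of "[]" "profile_word es cyc []"]] len1
    by (simp add: straight_matching_def)
  have match2: "computes program 9 [Leaf, enc_word (profile_word es (take k cyc) (drop k cyc))]
      (enc_list enc_edge (left_matching es (take k cyc) (drop k cyc))) (30 * (N * N + 1))"
    using computes_mono[OF computes_stack_matching
        [of "[]" "profile_word es (take k cyc) (drop k cyc)"]] len2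
    by (simp add: left_matching_def)
  have take: "computes program 13 [enc_nat k, enc_nats cyc] (enc_nats (take k cyc)) (20 * (N + 1))"
    by (rule computes_mono[OF computes_take]) (use assms(4) in simp)
  have drop: "computes program 14 [enc_nat k, enc_nats cyc] (enc_nats (drop k cyc)) (20 * (N + 1))"
    by (rule computes_mono[OF computes_drop]) (use assms(4) in simp)
  have app: "computes program 11 [enc_list enc_edge (left_matching es (take k cyc) (drop k cyc)),
      enc_list enc_edge (left_matching es (take k cyc) (drop k cyc))]
      (enc_list enc_edge (left_matching es (take k cyc) (drop k cyc) @
          left_matching es (take k cyc) (drop k cyc))) (20 * (N * N + 1))"
    by (rule computes_mono[OF computes_append]) (use len3 in simp)
  show ?thesis
    unfolding computes_def program_nth cover_body_def
    apply (simp add: wp_simps length_program)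
    apply (rule wp_call[OF word1[simplified]])
    apply (rule wp_call[OF match1])
    apply (rule wp_call[OF take])
    apply (rule wp_call[OF drop])
    apply (rule wp_call[OF word2])
    apply (rule wp_call[OF match2])
    apply (rule wp_call[OF take])
    apply (rule wp_call[OF drop])
    apply (rule wp_call[OF word2])
    apply (rule wp_call[OF match2])
    apply (rule wp_call[OF app])
    apply (simp add: cover_time_def)
    done
qed

definition main_time :: "nat \<Rightarrow> nat" where
  "main_time N = cover_time N + (N + 1) * (20 * (N + 1) + 40) + 20 * (N + 1) + 100"

lemma program_runs:
  assumes "\<forall>(i, j)\<in>set es. i < n \<and> j < n" "length es \<le> N" "n \<le> N" "m \<le> N" "k \<le> N"
    and cyc: "cyc = rotate m [0..<n]"
  shows "\<exists>t\<le>main_time N. runs program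
    (Node (enc_nat n) (Node (Node (enc_nat m) (enc_nat k)) (enc_edges es)))
    (Node (enc_edges (straight_matching es cyc))
      (enc_edges (left_matching es (take k cyc) (drop k cyc) @
        left_matching es (take k cyc) (drop k cyc)))) t"
proof -
  have upt: "computes program 10 [enc_nat n, Leaf] (enc_nats [0..<n]) (20 * (N + 1))"
    using computes_mono[OF computes_upt[of n 0]] assms(3) by simp
  have rot: "computes program 12 [enc_nat m, enc_nats [0..<n]] (enc_nats cyc)
      ((N + 1) * (20 * (N + 1) + 40))"
    unfolding cyc
    by (rule computes_mono[OF computes_rotate]) (use assms(3,4) in \<open>intro mult_mono; simp\<close>)
  have cover: "computes program (Suc 0) [enc_list enc_edge es, enc_nat k, enc_nats cyc]
    (Node (enc_list enc_edge (straight_matching es cyc))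
      (enc_list enc_edge (left_matching es (take k cyc) (drop k cyc) @
          left_matching es (take k cyc) (drop k cyc)))) (cover_time N)"
    by (rule computes_cover) (use assms in \<open>auto split: prod.splits\<close>)
  have "wp program [Node (enc_nat n) (Node (Node (enc_nat m) (enc_nat k)) (enc_list enc_edge es))]
    (Call 0 [Arg 0])
    (\<lambda>b t. b = Node (enc_list enc_edge (straight_matching es cyc))
      (enc_list enc_edge (left_matching es (take k cyc) (drop k cyc) @
          left_matching es (take k cyc) (drop k cyc))) \<and> t \<le> main_time N)"
    apply (simp add: wp_simps length_program)
    unfolding program_nth main_body_def
    apply (simp add: wp_simps length_program)
    apply (rule wp_call[OF upt])
    apply (rule wp_call[OF rot])
    apply (rule wp_call[OF cover])
    apply (simp add: main_time_def)
    done
  then show ?thesis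
    by (auto simp: wp_def runs_def enc_edges_eq)
qed

section \<open>Polynomial bounds\<close>

text \<open>Equality instead of a bound makes closure under sums and products immediate.\<close>

definition polynomial_time :: "(nat \<Rightarrow> nat) \<Rightarrow> bool" where
  "polynomial_time T \<longleftrightarrow> (\<exists>p :: nat poly. \<forall>N. poly p N = T N)"

lemma polynomial_time_const: "polynomial_time (\<lambda>_. c)"
  unfolding polynomial_time_def by (rule exI[of _ "[:c:]"]) simp

lemma polynomial_time_id: "polynomial_time (\<lambda>N. N)"
  unfolding polynomial_time_def by (rule exI[of _ "[:0, 1:]"]) simp

lemma polynomial_time_add:
  "polynomial_time S \<Longrightarrow> polynomial_time T \<Longrightarrow> polynomial_time (\<lambda>N. S N + T N)"
  unfolding polynomial_time_def by (metis poly_add)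

lemma polynomial_time_mult:
  "polynomial_time S \<Longrightarrow> polynomial_time T \<Longrightarrow> polynomial_time (\<lambda>N. S N * T N)"
  unfolding polynomial_time_def by (metis poly_mult)

lemmas polynomial_time_intros =
  polynomial_time_const polynomial_time_id polynomial_time_add polynomial_time_mult

lemma polynomial_time_main_time: "polynomial_time main_time"
  unfolding main_time_def cover_time_def profile_word_time_def min_cut_time_def cut_time_def
    mem_time_def
  by (intro polynomial_time_intros)

section \<open>Sizes of encodings and correctness of the program\<close>

lemma size_enc_nat [simp]: "size (enc_nat n) = n"
  by (induction n) auto

lemma length_le_size_enc_edges: "length es \<le> size (enc_edges es)"
  by (induction es rule: enc_edges.induct) auto

lemma size_enc_edges_le:
  "proper_edges n es \<Longrightarrow> size (enc_edges es) \<le> length es * (2 * n + 2)"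
  by (induction es rule: enc_edges.induct) (auto simp: proper_edges_def)

lemma proper_edges_append:
  "proper_edges n (es @ es') \<longleftrightarrow> proper_edges n es \<and> proper_edges n es'"
  by (auto simp: proper_edges_def)

lemma lists_demands_proper: "proper_edges (length F) es \<Longrightarrow> lists_demands F es (demands F es)"
  by (auto simp: proper_edges_def lists_demands_def demands_def)

text \<open>\<open>L1\<close> has at most \<open>N * N\<close> edges and \<open>L2\<close> twice as
  many; an edge takes at most \<open>2 * N + 2\<close> nodes, and the final 1 is the root.\<close>

definition output_size :: "nat \<Rightarrow> nat" where
  "output_size N = 3 * (N * N) * (2 * N + 2) + 1"

lemma program_correct:
  assumes inst: "segment_instance G F D S" and input: "encodes_input F D S a"
  shows "\<exists>L1 L2 b t. laminar_cover F D L1 L2 \<and> encodes_output F L1 L2 b \<and> runs program a b t \<and>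
    t \<le> main_time (size a) \<and> size b \<le> output_size (size a)"
proof -
  have F: "distinct F"
    using inst by (simp add: segment_instance_def facial_cycle_def)
  obtain m k es where m: "m < length F" and k: "k \<le> length F"
    and S: "S = set (take k (rotate m F))" and es: "lists_demands F es D"
    and a: "a = Node (enc_nat (length F)) (Node (Node (enc_nat m) (enc_nat k)) (enc_edges es))"
    using input unfolding encodes_input_def by blast
  define N where "N = size a"
  define cyc where "cyc = rotate m [0..<length F]"
  define ss ts where "ss = take k cyc" and "ts = drop k cyc"
  have cyc_eq: "rotate m [0..<length F] = ss @ ts" by (simp add: cyc_def ss_def ts_def)
  have set_cyc: "set ss \<union> set ts = {..<length F}"
    using arg_cong[OF cyc_eq, of set] by auto
  have disj: "set ss \<inter> set ts = {}"
    using arg_cong[OF cyc_eq, of distinct] by simp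
  have D: "D = demands F es" and bounds: "\<forall>(i, j)\<in>set es. i < length F \<and> j < length F"
    using es by (auto simp: lists_demands_def demands_def)
  \<comment> \<open>The first conjunct excludes loops, the second makes every demand join
    \<open>ss\<close> to \<open>ts\<close>.\<close>
  have edge: "card {F ! i, F ! j} = 2 \<and> card ({F ! i, F ! j} \<inter> S) = 1" if "(i, j) \<in> set es" for i j
  proof -
    have "{F ! i, F ! j} \<in># D" using that by (force simp: D demands_def)
    then show ?thesis using inst by (auto simp: segment_instance_def demands_on_def)
  qed
  have proper: "proper_edges (length F) es"
    using bounds edge by (fastforce simp: proper_edges_def)
  have "rotate m F = map ((!) F) cyc"
    unfolding cyc_def rotate_map[symmetric] by (simp add: map_nth)
  then have S_eq: "S = (!) F ` set ss"
    unfolding S ss_def by (simp add: take_map)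
  have "joins es (set ss) (set ts)"
    unfolding joins_def
  proof (intro ballI, clarify)
    fix i j assume ij: "(i, j) \<in> set es" and no: "\<not> (i \<in> set ts \<and> j \<in> set ss)"
    have lt: "i < length F" "j < length F" and ne: "F ! i \<noteq> F ! j"
      using bounds ij edge[OF ij] by auto
    have "(F ! i \<in> S) \<noteq> (F ! j \<in> S)"
      using edge[OF ij] card_doubleton_Int[OF ne] by simp
    then have "(i \<in> set ss) \<noteq> (j \<in> set ss)"
      unfolding S_eq using lt nth_mem_image_iff[OF F, of _ "set ss"] set_cyc by blast
    then show "i \<in> set ss \<and> j \<in> set ts"
      using lt set_cyc no by blast
  qed
  note cover = laminar_cover_matchings[OF F proper cyc_eq this]
  let ?L1 = "straight_matching es (ss @ ts)" and ?M = "left_matching es ss ts"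
  have N: "length es \<le> N" "length F \<le> N" "m \<le> N" "k \<le> N"
    using length_le_size_enc_edges[of es] m k by (simp_all add: N_def a)
  obtain t where t: "t \<le> main_time N"
    "runs program a (Node (enc_edges ?L1) (enc_edges (?M @ ?M))) t"
    using program_runs[OF bounds N refl] unfolding a cyc_eq[symmetric] ss_def ts_def cyc_def
    by auto
  have len: "length vs \<le> N \<Longrightarrow> length (stack_matching [] (profile_word es vs ys)) \<le> N * N" for vs ys
    using length_stack_matching[of "[]" "profile_word es vs ys"] length_profile_word[of es vs ys]
      mult_mono[OF _ N(1), of "length vs" N] by force
  have "length (ss @ ts) \<le> N" using N(2) by (simp flip: cyc_eq)
  then have len1: "length ?L1 \<le> N * N" and len2: "length ?M \<le> N * N"
    unfolding straight_matching_def left_matching_def by (intro len; simp)+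
  have "size (enc_edges E) \<le> c * (N * N) * (2 * N + 2)"
    if "proper_edges (length F) E" "length E \<le> c * (N * N)" for c E
  proof -
    have "size (enc_edges E) \<le> length E * (2 * length F + 2)"
      by (rule size_enc_edges_le[OF that(1)])
    also have "\<dots> \<le> c * (N * N) * (2 * N + 2)"
      by (rule mult_mono) (use that(2) N(2) in auto)
    finally show ?thesis .
  qed
  \<comment> \<open>The factors 1 and 2 account for the two copies in \<open>L2\<close>.\<close>
  from this[of ?L1 1] this[of "?M @ ?M" 2]
  have "size (Node (enc_edges ?L1) (enc_edges (?M @ ?M))) \<le> output_size N"
    using cover(2,3) len1 len2 by (simp add: proper_edges_append output_size_def)
  moreover have "encodes_output F (demands F ?L1) (demands F (?M @ ?M))
      (Node (enc_edges ?L1) (enc_edges (?M @ ?M)))"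
    unfolding encodes_output_def using cover(2,3) lists_demands_proper proper_edges_append by blast
  ultimately show ?thesis
    using cover(1) t unfolding D N_def by blast
qed

lemma input_encoding_exists:
  assumes "segment_instance G F D S"
  shows "\<exists>a. encodes_input F D S a"
proof -
  have F: "F \<noteq> []" and D: "demands_on F D" and "contiguous_segment F S"
    using assms by (auto simp: segment_instance_def facial_cycle_def)
  then obtain m k where S: "S = set (take k (rotate m F))"
    by (auto simp: contiguous_segment_def)
  have "\<exists>es. lists_demands F es D"
    using D
  proof (induction D)
    case empty
    then show ?case by (auto simp: lists_demands_def)
  next
    case (add e D)
    then obtain es where es: "lists_demands F es D" by (auto simp: demands_on_def)
    obtain x y where "e = {x, y}" "x \<in> set F" "y \<in> set F"
      using add.prems by (auto simp: demands_on_def card_2_iff)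
    then obtain i j where "i < length F" "j < length F" "e = {F ! i, F ! j}"
      by (metis in_set_conv_nth)
    with es have "lists_demands F ((i, j) # es) (add_mset e D)"
      by (auto simp: lists_demands_def)
    then show ?case by blast
  qed
  then obtain es where es: "lists_demands F es D" by blast
  \<comment> \<open>An encoding requires an offset below the length and a count of at most the
    length, so the offset is reduced modulo the length and the count truncated.\<close>
  have "S = set (take (min k (length F)) (rotate (m mod length F) F))"
    unfolding S by (metis length_rotate min.commute rotate_conv_mod take_all_iff take_take
        dual_order.refl)
  then show ?thesis
    unfolding encodes_input_def using F es
    by (metis length_greater_0_conv min.cobounded2 mod_less_divisor)
qed

theorem theorem3:
  "(\<forall>G F D S. segment_instance G F D S \<longrightarrow> (\<exists>L1 L2. laminar_cover F D L1 L2)) \<and>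
   (\<exists>(P :: prog) (p :: nat poly). \<forall>G F D S a.
      segment_instance G F D S \<and> encodes_input F D S a \<longrightarrow>
      (\<exists>L1 L2 b t. laminar_cover F D L1 L2 \<and> encodes_output F L1 L2 b \<and>
         runs P a b t \<and> t \<le> poly p (size a) \<and> size b \<le> poly p (size a)))"
proof (intro conjI allI impI)
  fix G F D S assume "segment_instance G F D S"
  \<comment> \<open>Existence is read off the output of the program on any encoding of the
    instance.\<close>
  then show "\<exists>L1 L2. laminar_cover F D L1 L2"
    using input_encoding_exists program_correct by blast
next
  \<comment> \<open>One polynomial has to bound both time and output size; the sum does.\<close>
  have "polynomial_time (\<lambda>N. main_time N + output_size N)"
    unfolding output_size_def
    by (intro polynomial_time_intros polynomial_time_main_time)
  then obtain p :: "nat poly" where p: "\<And>N. poly p N = main_time N + output_size N"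
    unfolding polynomial_time_def by blast
  show "\<exists>(P :: prog) (p :: nat poly). \<forall>G F D S a.
      segment_instance G F D S \<and> encodes_input F D S a \<longrightarrow>
      (\<exists>L1 L2 b t. laminar_cover F D L1 L2 \<and> encodes_output F L1 L2 b \<and>
         runs P a b t \<and> t \<le> poly p (size a) \<and> size b \<le> poly p (size a))"
    using program_correct by (intro exI[of _ program] exI[of _ p])
      (metis p trans_le_add1 trans_le_add2)
qed

end
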